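(* Let $n\geq 2$ and let $G$ be the $(2n+1)$-dimensional Heisenberg group, $G=\langle x_1,\dots,x_{2n+1}\mid [x_i,x_{n+i}]=x_{2n+1}\ (1\le i\le n),\ \text{all other pairs } x_j,x_k \text{ commute}\rangle$, with Mal'cev basis $(x_1,\dots,x_{2n+1})$. Then for every ordering of the basis of $\mathfrak{R}G/I^3$ for which the Jennings representation of $G$ is upper unitriangular, the image of $G$ in $UT_d(\mathbb{Z})$ ($d=\dim \mathfrak{R}G/I^3$) is a distorted subgroup.
   Context: $UT_d(\mathbb{Z})$ is the group of upper unitriangular $d\times d$ integer matrices. Jennings representation: $G$ has nilpotency class $2$; $\mathfrak{R}$ is a field of characteristic $0$, $I$ is the augmentation ideal of the group algebra $\mathfrak{R}G$. With $u_i=1-x_i$, $\mu(u_i)=1$ for $i\le 2n$ and $\mu(u_{2n+1})=2$, the cosets of the products $u_1^{r_1}\cdots u_{2n+1}^{r_{2n+1}}$ with $\sum r_i\mu(u_i)\le 2$ form a basis of $\mathfrak{R}G/I^3$; $G$ acts faithfully on $\mathfrak{R}G/I^3$ by right multiplication, by integer matrices w.r.t. this basis, and an ordering of the basis making all these matrices upper unitriangular gives an embedding $G\to UT_d(\mathbb{Z})$. A subgroup $H$ of a finitely generated group $K$ is distorted if its distortion function $\Delta_H^K(n)=\max\{dist_H(1,h): h\in H, dist_K(1,h)\le n\}$ (word metrics) is not bounded by $Cn$ for a constant $C$ (equivalently, not $\sim n$). *)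

theory Defs
  imports Complex_Main "HOL-Algebra.Generated_Groups"
begin

text \<open>Indices are 0-based: the generator x_{i+1} of the paper is index i, for i < 2n+1;
  the central generator x_{2n+1} is index 2n.  An element is the exponent vector
  (a_0,...,a_{2n}) of its Mal'cev normal form x_1^{a_0} ... x_{2n+1}^{a_{2n}};
  all other coordinates are 0.  Commutator convention [x,y] = x^-1 y^-1 x y,
  relations [x_i, x_{n+i}] = x_{2n+1}.\<close>

definition heis_carrier :: "nat \<Rightarrow> (nat \<Rightarrow> int) set" where
  "heis_carrier n = {v. \<forall>i\<ge>2*n+1. v i = 0}"

definition heis_mult :: "nat \<Rightarrow> (nat \<Rightarrow> int) \<Rightarrow> (nat \<Rightarrow> int) \<Rightarrow> (nat \<Rightarrow> int)" where
  "heis_mult n v w = (\<lambda>i. if i < 2*n then v i + w i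
      else if i = 2*n then v i + w i - (\<Sum>j<n. v (n+j) * w j) else 0)"

definition heis_one :: "nat \<Rightarrow> int" where
  "heis_one = (\<lambda>_. 0)"

definition heis_gen :: "nat \<Rightarrow> nat \<Rightarrow> int" where
  "heis_gen i = (\<lambda>j. if j = i then 1 else 0)"

definition gsupp :: "('a \<Rightarrow> 'k::zero) \<Rightarrow> 'a set" where
  "gsupp f = {y. f y \<noteq> 0}"

definition grp_alg :: "nat \<Rightarrow> ((nat \<Rightarrow> int) \<Rightarrow> 'k::field) set" where
  "grp_alg n = {f. finite (gsupp f) \<and> gsupp f \<subseteq> heis_carrier n}"

definition conv :: "nat \<Rightarrow> ((nat \<Rightarrow> int) \<Rightarrow> 'k::field) \<Rightarrow> ((nat \<Rightarrow> int) \<Rightarrow> 'k)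
    \<Rightarrow> ((nat \<Rightarrow> int) \<Rightarrow> 'k)" where
  "conv n f g = (\<lambda>x. \<Sum>y\<in>gsupp f. \<Sum>z\<in>gsupp g. if heis_mult n y z = x then f y * g z else 0)"

definition gdelta :: "(nat \<Rightarrow> int) \<Rightarrow> ((nat \<Rightarrow> int) \<Rightarrow> 'k::field)" where
  "gdelta x = (\<lambda>y. if y = x then 1 else 0)"

definition augmentation :: "((nat \<Rightarrow> int) \<Rightarrow> 'k::field) \<Rightarrow> 'k" where
  "augmentation f = (\<Sum>y\<in>gsupp f. f y)"

definition aug_ideal :: "nat \<Rightarrow> ((nat \<Rightarrow> int) \<Rightarrow> 'k::field) set" where
  "aug_ideal n = {f \<in> grp_alg n. augmentation f = 0}"

text \<open>I^3: all finite sums of products a*b*c with a, b, c in I (this is the k-span,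
  since I is a k-subspace).\<close>
definition aug_ideal_cube :: "nat \<Rightarrow> ((nat \<Rightarrow> int) \<Rightarrow> 'k::field) set" where
  "aug_ideal_cube n = {foldr (\<lambda>f g x. f x + g x) xs (\<lambda>_. 0) | xs.
      set xs \<subseteq> {conv n (conv n a b) c | a b c. a \<in> aug_ideal n \<and> b \<in> aug_ideal n \<and> c \<in> aug_ideal n}}"

definition uu :: "nat \<Rightarrow> ((nat \<Rightarrow> int) \<Rightarrow> 'k::field)" where
  "uu i = (\<lambda>y. gdelta heis_one y - gdelta (heis_gen i) y)"

definition jbasis :: "nat \<Rightarrow> (nat \<Rightarrow> nat) set" where
  "jbasis n = {r. (\<forall>i\<ge>2*n+1. r i = 0) \<and> (\<Sum>i<2*n. r i) + 2 * r (2*n) \<le> 2}"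

definition jbelem :: "nat \<Rightarrow> (nat \<Rightarrow> nat) \<Rightarrow> ((nat \<Rightarrow> int) \<Rightarrow> 'k::field)" where
  "jbelem n r = foldr (conv n) (concat (map (\<lambda>i. replicate (r i) (uu i)) [0..<2*n+1])) (gdelta heis_one)"

definition jcoef :: "'k::field_char_0 itself \<Rightarrow> nat \<Rightarrow> (nat \<Rightarrow> int) \<Rightarrow> (nat \<Rightarrow> nat) \<Rightarrow> (nat \<Rightarrow> nat) \<Rightarrow> 'k" where
  "jcoef K n g r = (THE c :: (nat \<Rightarrow> nat) \<Rightarrow> 'k. (\<forall>t. t \<notin> jbasis n \<longrightarrow> c t = 0) \<and>
      (\<lambda>x. conv n (jbelem n r) (gdelta g) x - (\<Sum>t\<in>jbasis n. c t * jbelem n t x)) \<in> aug_ideal_cube n)"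

definition UT :: "nat \<Rightarrow> (nat \<Rightarrow> nat \<Rightarrow> int) monoid" where
  "UT d = \<lparr>carrier = {A. (\<forall>i j. (i \<ge> d \<or> j \<ge> d) \<longrightarrow> A i j = 0) \<and>
                          (\<forall>i<d. \<forall>j<d. (j < i \<longrightarrow> A i j = 0) \<and> (i = j \<longrightarrow> A i j = 1))},
           mult = (\<lambda>A B i j. if i < d \<and> j < d then (\<Sum>k<d. A i k * B k j) else 0),
           one = (\<lambda>i j. if i < d \<and> j = i then 1 else 0)\<rparr>"

text \<open>Jennings matrix of g w.r.t. the ordering sigma : basis -> {..<d} (row convention:
  row i holds the coordinates of (basis element i) * g).  The entries are integers.\<close>
definition jmat :: "'k::field_char_0 itself \<Rightarrow> nat \<Rightarrow> ((nat \<Rightarrow> nat) \<Rightarrow> nat) \<Rightarrow> (nat \<Rightarrow> int)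
    \<Rightarrow> (nat \<Rightarrow> nat \<Rightarrow> int)" where
  "jmat K n \<sigma> g = (\<lambda>i j. if i < card (jbasis n) \<and> j < card (jbasis n) then
      (THE z :: int. of_int z = jcoef K n g (inv_into (jbasis n) \<sigma> i) (inv_into (jbasis n) \<sigma> j))
      else 0)"

definition word_len :: "('a, 'b) monoid_scheme \<Rightarrow> 'a set \<Rightarrow> 'a \<Rightarrow> nat" where
  "word_len G S g = (LEAST k. \<exists>ws. length ws = k \<and> set ws \<subseteq> S \<union> m_inv G ` S \<and>
      foldr (mult G) ws (one G) = g)"

definition distortion :: "('a, 'b) monoid_scheme \<Rightarrow> 'a set \<Rightarrow> 'a set \<Rightarrow> 'a set \<Rightarrow> nat \<Rightarrow> nat" where
  "distortion K H S T m = Sup {word_len (K\<lparr>carrier := H\<rparr>) S h | h. h \<in> H \<and> word_len K T h \<le> m}"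

definition distorted :: "('a, 'b) monoid_scheme \<Rightarrow> 'a set \<Rightarrow> bool" where
  "distorted K H \<longleftrightarrow> (\<forall>S T. finite S \<and> S \<subseteq> H \<and> generate (K\<lparr>carrier := H\<rparr>) S = H \<and>
      finite T \<and> T \<subseteq> carrier K \<and> generate K T = carrier K \<longrightarrow>
      \<not> (\<exists>C::real. \<forall>m. real (distortion K H S T m) \<le> C * real m))"

end

theory Submission
  imports Defs
begin

text \<open>
  Write \<open>z\<close> for the central generator.  The functions \<open>v \<mapsto> \<Prod>\<^sub>i (-1)^r\<^sub>i binom(v\<^sub>i, r\<^sub>i)\<close> of the Mal'cev
  coordinates are dual to the Jennings basis, and those of weight at most 2 vanish on \<open>I\<^sup>3\<close>;
  conversely \<open>g \<mapsto> g + I\<^sup>3\<close> is a quadratic map, which gives spanning.  So the matrix entries of \<open>g\<close>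
  are these functions evaluated along right translation by \<open>g\<close>.  In particular \<open>z\<^sup>m\<close> maps to the
  elementary matrix with entry \<open>-m\<close> in position \<open>(1, u\<^sub>2\<^sub>n\<^sub>+\<^sub>1)\<close>.  In every unitriangular ordering the
  \<open>n \<ge> 2\<close> elements \<open>u\<^sub>n\<^sub>+\<^sub>1, \<dots>, u\<^sub>2\<^sub>n\<close> lie strictly between \<open>1\<close> and \<open>u\<^sub>2\<^sub>n\<^sub>+\<^sub>1\<close>, so a threefold
  commutator writes the image of \<open>z^(m^3)\<close> as a word of length \<open>O(m)\<close> in the unitriangular group,
  whereas a word of length \<open>L\<close> in the Heisenberg group has central coordinate \<open>O(L\<^sup>2)\<close>.
\<close>

section \<open>Word length\<close>

lemma foldr_mult_closed:
  assumes "monoid G" "set us \<subseteq> carrier G"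
  shows "foldr (mult G) us (one G) \<in> carrier G"
  using assms(2) by (induction us) (auto intro: monoid.m_closed[OF assms(1)] monoid.one_closed[OF assms(1)])

lemma foldr_mult_append:
  assumes "monoid G" "set us \<subseteq> carrier G" "set vs \<subseteq> carrier G"
  shows "foldr (mult G) (us @ vs) (one G) = mult G (foldr (mult G) us (one G)) (foldr (mult G) vs (one G))"
  using assms(2)
proof (induction us)
  case Nil
  show ?case using foldr_mult_closed[OF assms(1,3)] by (simp add: monoid.l_one[OF assms(1)])
next
  case (Cons a us)
  then show ?case
    using foldr_mult_closed[OF assms(1)] assms(3) by (simp add: monoid.m_assoc[OF assms(1)])
qed

text \<open>\<open>generate\<close> contains the inverses of its generators by definition. So once
  \<open>S\<close> generates, all letters of a word lie in the carrier, also when \<open>G\<close>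
  is only known to be a monoid.\<close>

lemma inv_image_subset_generate: "S \<union> m_inv G ` S \<subseteq> generate G S"
  by (auto intro: generate.incl generate.inv)

lemma word_len_le:
  assumes "set ws \<subseteq> S \<union> m_inv G ` S" "foldr (mult G) ws (one G) = g"
  shows "word_len G S g \<le> length ws"
  unfolding word_len_def by (rule Least_le) (use assms in blast)

text \<open>The \<open>LEAST\<close> in \<open>word_len\<close> has meaning only if some word
  exists; induction on \<open>generate\<close> builds one, with concatenation for products.\<close>

lemma word_len_attained:
  assumes "monoid G" "generate G S = carrier G" "g \<in> carrier G"
  obtains ws where "length ws = word_len G S g" "set ws \<subseteq> S \<union> m_inv G ` S"
    "foldr (mult G) ws (one G) = g"
proof -
  have sub: "S \<union> m_inv G ` S \<subseteq> carrier G"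
    using inv_image_subset_generate[of S G] assms(2) by simp
  have "g \<in> generate G S" using assms by simp
  then have "\<exists>ws. set ws \<subseteq> S \<union> m_inv G ` S \<and> foldr (mult G) ws (one G) = g"
  proof (induction rule: generate.induct)
    case one
    show ?case by (rule exI[of _ "[]"]) simp
  next
    case (incl h)
    then show ?case using sub by (intro exI[of _ "[h]"]) (auto simp: monoid.r_one[OF assms(1)])
  next
    case (inv h)
    then show ?case using sub by (intro exI[of _ "[m_inv G h]"]) (auto simp: monoid.r_one[OF assms(1)])
  next
    case (eng h1 h2)
    then obtain us vs where "set us \<subseteq> S \<union> m_inv G ` S" "foldr (mult G) us (one G) = h1"
      "set vs \<subseteq> S \<union> m_inv G ` S" "foldr (mult G) vs (one G) = h2" by blast
    then show ?case
      using foldr_mult_append[OF assms(1) order.trans[OF _ sub] order.trans[OF _ sub], of us vs]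
      by (intro exI[of _ "us @ vs"]) (simp del: foldr_append)
  qed
  then have "\<exists>k ws. length ws = k \<and> set ws \<subseteq> S \<union> m_inv G ` S \<and> foldr (mult G) ws (one G) = g"
    by blast
  from LeastI_ex[OF this] show ?thesis
    unfolding word_len_def[symmetric] using that by blast
qed

lemma word_len_mult_le:
  assumes "monoid G" "generate G S = carrier G" "g \<in> carrier G" "h \<in> carrier G"
  shows "word_len G S (mult G g h) \<le> word_len G S g + word_len G S h"
proof -
  have sub: "S \<union> m_inv G ` S \<subseteq> carrier G"
    using inv_image_subset_generate[of S G] assms(2) by simp
  obtain us where us: "length us = word_len G S g" "set us \<subseteq> S \<union> m_inv G ` S"
    "foldr (mult G) us (one G) = g" using word_len_attained[OF assms(1-3)] by blast
  obtain vs where vs: "length vs = word_len G S h" "set vs \<subseteq> S \<union> m_inv G ` S"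
    "foldr (mult G) vs (one G) = h" using word_len_attained[OF assms(1,2,4)] by blast
  have "word_len G S (mult G g h) \<le> length (us @ vs)"
  proof (rule word_len_le)
    show "set (us @ vs) \<subseteq> S \<union> m_inv G ` S" using us vs by simp
    show "foldr (mult G) (us @ vs) (one G) = mult G g h"
      using us vs foldr_mult_append[OF assms(1) order.trans[OF _ sub] order.trans[OF _ sub], of us vs]
      by (simp del: foldr_append)
  qed
  then show ?thesis using us vs by simp
qed

text \<open>A shortest word for \<open>f 1\<close>, repeated \<open>k\<close> times, spells
  \<open>f k\<close>. The family \<open>f\<close> stands for powers, so that elementary matrices can
  be inserted with their entry as exponent.\<close>

lemma word_len_power_le:
  assumes "monoid G" "generate G S = carrier G" "\<And>k. f k \<in> carrier G"
    and "f 0 = one G" "\<And>k. f (Suc k) = mult G (f 1) (f k)"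
  shows "word_len G S (f k) \<le> k * word_len G S (f 1)"
proof (induction k)
  case 0
  show ?case using word_len_le[of "[]" S G "f 0"] assms(4) by simp
next
  case (Suc k)
  have "word_len G S (f (Suc k)) \<le> word_len G S (f 1) + word_len G S (f k)"
    unfolding assms(5)[of k] by (intro word_len_mult_le assms)
  then show ?case using Suc by simp
qed

lemma finite_word_ball:
  assumes "monoid G" "generate G S = carrier G" "finite S"
  shows "finite {g \<in> carrier G. word_len G S g \<le> m}"
proof (rule finite_subset)
  show "{g \<in> carrier G. word_len G S g \<le> m} \<subseteq>
      (\<lambda>ws. foldr (mult G) ws (one G)) ` {ws. set ws \<subseteq> S \<union> m_inv G ` S \<and> length ws \<le> m}"
  proof
    fix g assume "g \<in> {g \<in> carrier G. word_len G S g \<le> m}"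
    then obtain ws where "length ws \<le> m" "set ws \<subseteq> S \<union> m_inv G ` S" "foldr (mult G) ws (one G) = g"
      using word_len_attained[OF assms(1,2), of g] by (metis (no_types, lifting) mem_Collect_eq)
    then show "g \<in> (\<lambda>ws. foldr (mult G) ws (one G)) ` {ws. set ws \<subseteq> S \<union> m_inv G ` S \<and> length ws \<le> m}"
      by blast
  qed
  show "finite ((\<lambda>ws. foldr (mult G) ws (one G)) ` {ws. set ws \<subseteq> S \<union> m_inv G ` S \<and> length ws \<le> m})"
    using assms(3) by (intro finite_imageI finite_lists_length_le) auto
qed

text \<open>On natural numbers \<open>Sup\<close> is an upper bound only for bounded sets; the
  finiteness of balls over a finite alphabet supplies the bound.\<close>

lemma word_len_le_distortion:
  assumes "monoid G" "generate G T = carrier G" "finite T" "H \<subseteq> carrier G"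
    and "h \<in> H" "word_len G T h \<le> m"
  shows "word_len (G\<lparr>carrier := H\<rparr>) S h \<le> distortion G H S T m"
proof -
  have "finite {h \<in> H. word_len G T h \<le> m}"
    by (rule finite_subset[OF _ finite_word_ball[OF assms(1-3), of m]]) (use assms(4) in auto)
  then have "finite (word_len (G\<lparr>carrier := H\<rparr>) S ` {h \<in> H. word_len G T h \<le> m})" by simp
  moreover have "{word_len (G\<lparr>carrier := H\<rparr>) S h | h. h \<in> H \<and> word_len G T h \<le> m} =
      word_len (G\<lparr>carrier := H\<rparr>) S ` {h \<in> H. word_len G T h \<le> m}" by auto
  ultimately show ?thesis unfolding distortion_def
    using assms(5,6) by (intro cSup_upper) (auto intro: bdd_above_finite)
qed

section \<open>Elementary unitriangular matrices\<close>

lemma UT_mult: "A \<otimes>\<^bsub>UT d\<^esub> B = (\<lambda>i j. if i < d \<and> j < d then (\<Sum>k<d. A i k * B k j) else 0)"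
  by (simp add: UT_def)

lemma UT_one: "\<one>\<^bsub>UT d\<^esub> = (\<lambda>i j. if i < d \<and> j = i then 1 else 0)"
  by (simp add: UT_def)

lemma UT_carrier: "A \<in> carrier (UT d) \<longleftrightarrow> (\<forall>i j. (i \<ge> d \<or> j \<ge> d) \<longrightarrow> A i j = 0) \<and>
    (\<forall>i<d. \<forall>j<d. (j < i \<longrightarrow> A i j = 0) \<and> (i = j \<longrightarrow> A i j = 1))"
  by (simp add: UT_def)

lemma monoid_UT: "monoid (UT d)"
proof (rule monoidI)
  fix A B assume A: "A \<in> carrier (UT d)" and B: "B \<in> carrier (UT d)"
  \<comment> \<open>If j < i, every k satisfies k < i or j < k, so one of the two factors lies below
    the diagonal.\<close>
  have low: "A i k * B k j = 0" if "i < d" "j < d" "k < d" "j < i" for i j k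
    using A B that unfolding UT_carrier by (cases "k < i") auto
  have diag: "A i k * B k i = (if k = i then 1 else 0)" if "i < d" "k < d" for i k
    using A B that unfolding UT_carrier by (cases "k < i"; cases "i < k") auto
  show "A \<otimes>\<^bsub>UT d\<^esub> B \<in> carrier (UT d)"
    unfolding UT_carrier UT_mult by (auto simp: low diag)
next
  fix A B C
  show "A \<otimes>\<^bsub>UT d\<^esub> B \<otimes>\<^bsub>UT d\<^esub> C = A \<otimes>\<^bsub>UT d\<^esub> (B \<otimes>\<^bsub>UT d\<^esub> C)"
  proof (intro ext)
    fix i j
    have "(\<Sum>k<d. (\<Sum>l<d. A i l * B l k) * C k j) = (\<Sum>l<d. A i l * (\<Sum>k<d. B l k * C k j))"
      by (simp add: sum_distrib_left sum_distrib_right mult.assoc) (rule sum.swap)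
    then show "(A \<otimes>\<^bsub>UT d\<^esub> B \<otimes>\<^bsub>UT d\<^esub> C) i j = (A \<otimes>\<^bsub>UT d\<^esub> (B \<otimes>\<^bsub>UT d\<^esub> C)) i j"
      by (simp add: UT_mult)
  qed
next
  fix A assume A: "A \<in> carrier (UT d)"
  show "\<one>\<^bsub>UT d\<^esub> \<otimes>\<^bsub>UT d\<^esub> A = A" "A \<otimes>\<^bsub>UT d\<^esub> \<one>\<^bsub>UT d\<^esub> = A"
    using A by (auto simp: fun_eq_iff UT_mult UT_one UT_carrier if_distrib if_distribR cong: if_cong)
next
  show "\<one>\<^bsub>UT d\<^esub> \<in> carrier (UT d)" by (auto simp: UT_carrier UT_one)
qed

definition elem_mat :: "nat \<Rightarrow> nat \<Rightarrow> nat \<Rightarrow> int \<Rightarrow> nat \<Rightarrow> nat \<Rightarrow> int" where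
  "elem_mat d i j a = (\<lambda>p q. if p < d \<and> q < d then
      (if p = q then 1 else if p = i \<and> q = j then a else 0) else 0)"

lemma elem_mat_carrier: "i < j \<Longrightarrow> elem_mat d i j a \<in> carrier (UT d)"
  by (auto simp: UT_carrier elem_mat_def)

text \<open>Left multiplication by an elementary matrix is a row operation, since each of its rows
  has at most two nonzero entries.\<close>

lemma elem_mat_mult:
  assumes "i < j" "j < d"
  shows "elem_mat d i j a \<otimes>\<^bsub>UT d\<^esub> B =
    (\<lambda>p q. if p < d \<and> q < d then B p q + (if p = i then a * B j q else 0) else 0)"
proof (intro ext)
  fix p q
  have "(\<Sum>k<d. elem_mat d i j a p k * B k q) = B p q + (if p = i then a * B j q else 0)" if "p < d" "q < d"
  proof -
    have "elem_mat d i j a p k * B k q =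
      (if k = p then B p q else 0) + (if k = j then (if p = i then a * B j q else 0) else 0)" if "k < d" for k
      using that \<open>p < d\<close> assms by (auto simp: elem_mat_def)
    then show ?thesis using that assms by (simp add: sum.distrib)
  qed
  then show "(elem_mat d i j a \<otimes>\<^bsub>UT d\<^esub> B) p q =
    (if p < d \<and> q < d then B p q + (if p = i then a * B j q else 0) else 0)"
    by (simp add: UT_mult)
qed

lemma elem_mat_add:
  assumes "i < j" "j < d"
  shows "elem_mat d i j a \<otimes>\<^bsub>UT d\<^esub> elem_mat d i j b = elem_mat d i j (a + b)"
  unfolding elem_mat_mult[OF assms] using assms by (auto simp: elem_mat_def fun_eq_iff)

text \<open>The Steinberg commutator relation. Inverses are written as elementary matrices with
  negated entry, so that \<open>m_inv\<close> does not occur.\<close>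

lemma elem_mat_commutator:
  assumes "i < k" "k < j" "j < d"
  shows "elem_mat d i k a \<otimes>\<^bsub>UT d\<^esub> (elem_mat d k j b \<otimes>\<^bsub>UT d\<^esub>
    (elem_mat d i k (- a) \<otimes>\<^bsub>UT d\<^esub> elem_mat d k j (- b))) = elem_mat d i j (a * b)"
proof -
  have "k < d" "i < d" using assms by auto
  then show ?thesis
    unfolding elem_mat_mult[OF assms(1) \<open>k < d\<close>] elem_mat_mult[OF assms(2,3)]
    using assms by (auto simp: elem_mat_def fun_eq_iff)
qed

lemma word_len_commutator_le:
  assumes gen: "generate (UT d) T = carrier (UT d)" and ord: "i < k" "k < j" "j < d"
  shows "word_len (UT d) T (elem_mat d i j (a * b)) \<le>
    word_len (UT d) T (elem_mat d i k a) + word_len (UT d) T (elem_mat d k j b) +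
    word_len (UT d) T (elem_mat d i k (- a)) + word_len (UT d) T (elem_mat d k j (- b))"
proof -
  note le = word_len_mult_le[OF monoid_UT gen]
  note cl = elem_mat_carrier[OF ord(1), of d] elem_mat_carrier[OF ord(2), of d]
  note mcl = monoid.m_closed[OF monoid_UT]
  show ?thesis
    using le[OF cl(1) mcl[OF cl(2) mcl[OF cl]], of a b "- a" "- b"]
      le[OF cl(2) mcl[OF cl], of b "- a" "- b"] le[OF cl, of "- a" "- b"]
    unfolding elem_mat_commutator[OF ord] by linarith
qed

text \<open>Entries add under multiplication, so powers of the matrices with entry 1 and -1 suffice.
  Both signs are recorded because a commutator uses each factor and its inverse.\<close>

lemma word_len_elem_mat_linear:
  assumes gen: "generate (UT d) T = carrier (UT d)" and ord: "i < j" "j < d"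
  shows "\<exists>C. \<forall>m. word_len (UT d) T (elem_mat d i j (int m)) \<le> C * m \<and>
    word_len (UT d) T (elem_mat d i j (- int m)) \<le> C * m"
proof -
  have zero: "elem_mat d i j 0 = \<one>\<^bsub>UT d\<^esub>" by (auto simp: elem_mat_def UT_one fun_eq_iff)
  have *: "word_len (UT d) T (elem_mat d i j (s * int m)) \<le> m * word_len (UT d) T (elem_mat d i j s)" for s m
    using word_len_power_le[OF monoid_UT gen, of "\<lambda>m. elem_mat d i j (s * int m)" m] zero
    by (simp add: elem_mat_carrier ord elem_mat_add algebra_simps)
  show ?thesis
    using *[of 1] *[of "-1"]
    by (intro exI[of _ "word_len (UT d) T (elem_mat d i j 1) + word_len (UT d) T (elem_mat d i j (-1))"])
      (auto simp: algebra_simps intro: trans_le_add1 trans_le_add2)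
qed

text \<open>Two nested commutators along i < k < l < j multiply three entries of size m, while the
  number of letters stays linear in m. The sign is the one with which central elements are
  represented.\<close>

lemma word_len_elem_mat_cube:
  assumes gen: "generate (UT d) T = carrier (UT d)" and ord: "i < k" "k < l" "l < j" "j < d"
  shows "\<exists>C. \<forall>m. word_len (UT d) T (elem_mat d i j (- (int m ^ 3))) \<le> C * m"
proof -
  let ?w = "\<lambda>i j a. word_len (UT d) T (elem_mat d i j a)"
  obtain C1 where C1: "?w i k (int m) \<le> C1 * m" "?w i k (- int m) \<le> C1 * m" for m
    using word_len_elem_mat_linear[OF gen, of i k] ord by auto
  obtain C2 where C2: "?w k l (int m) \<le> C2 * m" "?w k l (- int m) \<le> C2 * m" for m
    using word_len_elem_mat_linear[OF gen, of k l] ord by auto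
  obtain C3 where C3: "?w l j (int m) \<le> C3 * m" "?w l j (- int m) \<le> C3 * m" for m
    using word_len_elem_mat_linear[OF gen, of l j] ord by auto
  \<comment> \<open>The outer commutator has two factors at (i, k) and two at (k, j); each of the
    latter is an inner commutator of length at most \<open>(2 * C2 + 2 * C3) * m\<close>.\<close>
  have "?w i j (- (int m ^ 3)) \<le> (2 * C1 + 4 * C2 + 4 * C3) * m" for m
  proof -
    have a: "?w k j (int m * int m) \<le> (2 * C2 + 2 * C3) * m"
      using word_len_commutator_le[OF gen ord(2-4), of "int m" "int m"] C2[of m] C3[of m]
      by (simp add: algebra_simps)
    have b: "?w k j (- (int m * int m)) \<le> (2 * C2 + 2 * C3) * m"
      using word_len_commutator_le[OF gen ord(2-4), of "- int m" "int m"] C2[of m] C3[of m]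
      by (simp add: algebra_simps)
    have "k < j" using ord by simp
    have "- (int m ^ 3) = int m * (- (int m * int m))" by (simp add: power3_eq_cube)
    then show ?thesis
      using word_len_commutator_le[OF gen ord(1) \<open>k < j\<close> ord(4), of "int m" "- (int m * int m)"] a b C1[of m]
      by (simp add: algebra_simps)
  qed
  then show ?thesis by blast
qed

section \<open>The Heisenberg group\<close>

lemma heis_mult_closed [simp]: "heis_mult n v w \<in> heis_carrier n"
  by (simp add: heis_carrier_def heis_mult_def)

lemma heis_one_closed [simp]: "heis_one \<in> heis_carrier n"
  by (simp add: heis_carrier_def heis_one_def)

lemma heis_gen_closed [simp]: "i \<le> 2 * n \<Longrightarrow> heis_gen i \<in> heis_carrier n"
  by (simp add: heis_carrier_def heis_gen_def)

lemma heis_carrier_mem: "v \<in> heis_carrier n \<longleftrightarrow> (\<forall>i>2*n. v i = 0)"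
  by (auto simp: heis_carrier_def)

lemma heis_mult_one [simp]:
  assumes "v \<in> heis_carrier n"
  shows "heis_mult n heis_one v = v" "heis_mult n v heis_one = v"
  using assms by (auto simp: heis_carrier_mem heis_mult_def heis_one_def fun_eq_iff)

lemma heis_mult_assoc: "heis_mult n (heis_mult n u v) w = heis_mult n u (heis_mult n v w)"
  by (auto simp: heis_mult_def fun_eq_iff algebra_simps sum.distrib)

text \<open>The correction term in the central coordinate involves at most \<open>v (i - n)\<close>,
  which stands before position \<open>i\<close>.\<close>

lemma heis_mult_gen_left:
  assumes "v \<in> heis_carrier n" "\<And>j. j < i \<Longrightarrow> v j = 0" "i \<le> 2 * n"
  shows "heis_mult n (heis_gen i) v = v(i := v i + 1)"
proof -
  have "(\<Sum>j<n. heis_gen i (n + j) * v j) = 0"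
    by (rule sum.neutral) (use assms(2) in \<open>auto simp: heis_gen_def\<close>)
  then show ?thesis using assms by (auto simp: heis_mult_def heis_gen_def heis_carrier_mem fun_eq_iff)
qed

text \<open>Here the correction term involves at most \<open>v (n + i)\<close>, which stands after
  position \<open>i\<close>.\<close>

lemma heis_mult_gen_right:
  assumes "v \<in> heis_carrier n" "\<And>j. j > i \<Longrightarrow> v j = 0" "i \<le> 2 * n" "0 < n"
  shows "heis_mult n v (heis_gen i) = v(i := v i + 1)"
proof -
  have "(\<Sum>j<n. v (n + j) * heis_gen i j) = 0"
    by (rule sum.neutral) (use assms(2,4) in \<open>auto simp: heis_gen_def\<close>)
  then show ?thesis using assms by (auto simp: heis_mult_def heis_gen_def heis_carrier_mem fun_eq_iff)
qed

text \<open>Coordinates are filled from left to right: when coordinate \<open>j\<close> changes, all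
  later ones are still 0, so the change is a right multiplication by a generator. The equivalence in
  \<open>step\<close> also reaches negative exponents.\<close>

lemma malcev_induct:
  fixes v :: "nat \<Rightarrow> int"
  assumes "P (\<lambda>_. 0)"
    and step: "\<And>j v. j < k \<Longrightarrow> (\<And>i. i > j \<Longrightarrow> v i = 0) \<Longrightarrow> P (v(j := v j + 1)) \<longleftrightarrow> P v"
    and "\<And>i. i \<ge> k \<Longrightarrow> v i = 0"
  shows "P v"
  using step assms(3)
proof (induction k arbitrary: v)
  case 0
  then have "v = (\<lambda>_. 0)" by auto
  then show ?case using assms(1) by simp
next
  case (Suc k)
  have base: "P (v(k := 0))"
  proof (rule Suc.IH)
    show "P (w(j := w j + 1)) \<longleftrightarrow> P w" if "j < k" "\<And>i. i > j \<Longrightarrow> w i = 0" for j w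
      by (rule Suc.prems(1)) (use that in auto)
    show "(v(k := 0)) i = 0" if "i \<ge> k" for i
      using that Suc.prems(2)[of i] by (cases "i = k") auto
  qed
  have step: "P (v(k := a + 1)) \<longleftrightarrow> P (v(k := a))" for a
  proof -
    have "P ((v(k := a))(k := (v(k := a)) k + 1)) \<longleftrightarrow> P (v(k := a))"
      by (rule Suc.prems(1)) (use Suc.prems(2) in auto)
    moreover have "(v(k := a))(k := (v(k := a)) k + 1) = v(k := a + 1)" by simp
    ultimately show ?thesis by metis
  qed
  have "P (v(k := a))" for a
  proof (induction a rule: int_induct[of _ 0])
    case base
    show ?case by (rule \<open>P (v(k := 0))\<close>)
  next
    case (step1 i)
    show ?case using step1(2) step[of i] by (simp only:)
  next
    case (step2 i)
    show ?case using step2(2) step[of "i - 1"] by (simp only: diff_add_cancel)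
  qed
  from this[of "v k"] show ?case by (simp only: fun_upd_triv)
qed

section \<open>Linear functionals on the group algebra\<close>

text \<open>The linear extension of \<open>\<phi>\<close> from the group to the group algebra,
  evaluated at \<open>f\<close>.\<close>

definition pair :: "('a \<Rightarrow> 'k::field) \<Rightarrow> ('a \<Rightarrow> 'k) \<Rightarrow> 'k" where
  "pair \<phi> f = (\<Sum>y\<in>gsupp f. f y * \<phi> y)"

lemma pair_superset: "finite A \<Longrightarrow> gsupp f \<subseteq> A \<Longrightarrow> pair \<phi> f = (\<Sum>y\<in>A. f y * \<phi> y)"
  unfolding pair_def by (rule sum.mono_neutral_left) (auto simp: gsupp_def)

lemma pair_cong: "(\<And>y. y \<in> gsupp f \<Longrightarrow> \<phi> y = \<psi> y) \<Longrightarrow> pair \<phi> f = pair \<psi> f"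
  unfolding pair_def by (rule sum.cong) auto

lemma pair_add_left: "pair (\<lambda>y. \<phi> y + \<psi> y) f = pair \<phi> f + pair \<psi> f"
  by (simp add: pair_def algebra_simps sum.distrib)

lemma pair_diff_left: "pair (\<lambda>y. \<phi> y - \<psi> y) f = pair \<phi> f - pair \<psi> f"
  by (simp add: pair_def algebra_simps sum_subtractf)

lemma pair_scale_left: "pair (\<lambda>y. c * \<phi> y) f = c * pair \<phi> f"
  by (simp add: pair_def sum_distrib_left mult_ac)

lemma pair_sum_left: "pair (\<lambda>y. \<Sum>i\<in>A. \<phi> i y) f = (\<Sum>i\<in>A. pair (\<phi> i) f)"
  unfolding pair_def sum_distrib_left by (rule sum.swap)

lemma pair_const: "pair (\<lambda>_. c) f = c * augmentation f"
  by (simp add: pair_def augmentation_def sum_distrib_left mult_ac)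

lemma pair_lincomb:
  assumes "finite (gsupp f)" "finite (gsupp g)"
  shows "pair \<phi> (\<lambda>x. a * f x + b * g x) = a * pair \<phi> f + b * pair \<phi> g"
proof -
  let ?A = "gsupp f \<union> gsupp g"
  have "finite ?A" "gsupp (\<lambda>x. a * f x + b * g x) \<subseteq> ?A" using assms by (auto simp: gsupp_def)
  then show ?thesis
    by (simp add: pair_superset[of ?A] sum_distrib_left sum.distrib[symmetric] algebra_simps)
qed

lemma finite_gsupp_lincomb:
  assumes "finite (gsupp f)" "finite (gsupp g)"
  shows "finite (gsupp (\<lambda>x. a * f x + b * g x :: 'k::field))"
  by (rule finite_subset[of _ "gsupp f \<union> gsupp g"]) (use assms in \<open>auto simp: gsupp_def\<close>)

text \<open>Finiteness and value are proved together because the induction step for the value needs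
  the partial sum to have finite support.\<close>

lemma pair_sum:
  assumes "\<And>t. t \<in> A \<Longrightarrow> finite (gsupp (f t))"
  shows "finite (gsupp (\<lambda>x. \<Sum>t\<in>A. c t * f t x)) \<and>
    pair \<phi> (\<lambda>x. \<Sum>t\<in>A. c t * f t x) = (\<Sum>t\<in>A. c t * pair \<phi> (f t))"
  using assms
proof (induction A rule: infinite_finite_induct)
  case (infinite A)
  then show ?case by (simp add: gsupp_def pair_def)
next
  case empty
  then show ?case by (simp add: gsupp_def pair_def)
next
  case (insert t A)
  then show ?case
    using pair_lincomb[of "f t" "\<lambda>x. \<Sum>t\<in>A. c t * f t x" \<phi> "c t" 1]
      finite_gsupp_lincomb[of "f t" "\<lambda>x. \<Sum>t\<in>A. c t * f t x" "c t" 1] by simp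
qed

lemma gsupp_gdelta [simp]: "gsupp (gdelta a :: _ \<Rightarrow> 'k::field) = {a}"
  by (auto simp: gsupp_def gdelta_def)

lemma pair_gdelta [simp]: "pair \<phi> (gdelta a) = \<phi> a"
  by (simp add: pair_def) (simp add: gdelta_def)

lemma gsupp_conv: "gsupp (conv n f g) \<subseteq> (\<lambda>(y, z). heis_mult n y z) ` (gsupp f \<times> gsupp g)"
proof
  fix x assume "x \<in> gsupp (conv n f g)"
  then have "conv n f g x \<noteq> 0" by (simp add: gsupp_def)
  then obtain y where y: "y \<in> gsupp f" "(\<Sum>z\<in>gsupp g. if heis_mult n y z = x then f y * g z else 0) \<noteq> 0"
    unfolding conv_def by (meson sum.not_neutral_contains_not_neutral)
  from y(2) obtain z where z: "z \<in> gsupp g" "(if heis_mult n y z = x then f y * g z else 0) \<noteq> 0"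
    by (rule sum.not_neutral_contains_not_neutral)
  then have "heis_mult n y z = x" by presburger
  then show "x \<in> (\<lambda>(y, z). heis_mult n y z) ` (gsupp f \<times> gsupp g)"
    using y(1) z(1) by (intro image_eqI[of _ _ "(y, z)"]) simp_all
qed

lemma finite_gsupp_conv: "finite (gsupp f) \<Longrightarrow> finite (gsupp g) \<Longrightarrow> finite (gsupp (conv n f g))"
  by (rule finite_subset[OF gsupp_conv]) simp

text \<open>All sums run over the finite set of products of the two supports; after exchanging them,
  the condition in \<open>conv\<close> selects a single term for each pair.\<close>

lemma pair_conv:
  assumes "finite (gsupp f)" "finite (gsupp g)"
  shows "pair \<phi> (conv n f g) = pair (\<lambda>y. pair (\<lambda>z. \<phi> (heis_mult n y z)) g) f"
proof -
  let ?X = "(\<lambda>(y, z). heis_mult n y z) ` (gsupp f \<times> gsupp g)"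
  have fin: "finite ?X" using assms by simp
  have inner: "(\<Sum>x\<in>?X. (if heis_mult n y z = x then f y * g z else 0) * \<phi> x)
      = f y * (g z * \<phi> (heis_mult n y z))" if "y \<in> gsupp f" "z \<in> gsupp g" for y z
  proof -
    have "heis_mult n y z \<in> ?X" using that by force
    moreover have "(\<Sum>x\<in>?X. (if heis_mult n y z = x then f y * g z else 0) * \<phi> x)
      = (\<Sum>x\<in>?X. if heis_mult n y z = x then f y * g z * \<phi> x else 0)"
      by (rule sum.cong) auto
    ultimately show ?thesis using fin by simp
  qed
  have "pair \<phi> (conv n f g) = (\<Sum>x\<in>?X. conv n f g x * \<phi> x)"
    by (rule pair_superset[OF fin gsupp_conv])
  also have "\<dots> = (\<Sum>x\<in>?X. \<Sum>y\<in>gsupp f. \<Sum>z\<in>gsupp g. (if heis_mult n y z = x then f y * g z else 0) * \<phi> x)"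
    by (simp add: conv_def sum_distrib_right)
  also have "\<dots> = (\<Sum>y\<in>gsupp f. \<Sum>z\<in>gsupp g. \<Sum>x\<in>?X. (if heis_mult n y z = x then f y * g z else 0) * \<phi> x)"
    by (simp only: sum.swap[of _ _ ?X])
  also have "\<dots> = (\<Sum>y\<in>gsupp f. \<Sum>z\<in>gsupp g. f y * (g z * \<phi> (heis_mult n y z)))"
    by (intro sum.cong refl inner)
  also have "\<dots> = pair (\<lambda>y. pair (\<lambda>z. \<phi> (heis_mult n y z)) g) f"
    by (simp add: pair_def sum_distrib_left)
  finally show ?thesis .
qed

text \<open>Writes a coefficient of a product as an iterated pairing, so that \<open>conv\<close>
  inherits linearity from \<open>pair\<close>.\<close>

lemma conv_eq_pair:
  assumes "finite (gsupp f)" "finite (gsupp g)"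
  shows "conv n f g x = pair (\<lambda>y. pair (\<lambda>z. gdelta x (heis_mult n y z)) g) f"
  by (simp add: conv_def pair_def gdelta_def sum_distrib_left) (intro sum.cong refl, auto)

lemma conv_scale_left:
  assumes "finite (gsupp f)" "finite (gsupp g)"
  shows "conv n (\<lambda>x. c * f x) g = (\<lambda>x. c * conv n f g x)"
proof
  fix x
  have "finite (gsupp (\<lambda>x. c * f x))" using finite_gsupp_lincomb[OF assms(1,1), of c 0] by simp
  then show "conv n (\<lambda>x. c * f x) g x = c * conv n f g x"
    using pair_lincomb[OF assms(1,1), of _ c 0] assms by (simp add: conv_eq_pair)
qed

section \<open>Elements 1 - a of the augmentation ideal\<close>

definition one_minus :: "(nat \<Rightarrow> int) \<Rightarrow> (nat \<Rightarrow> int) \<Rightarrow> 'k::field" where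
  "one_minus a = (\<lambda>x. gdelta heis_one x - gdelta a x)"

lemma uu_eq_one_minus: "uu i = one_minus (heis_gen i)"
  by (simp add: uu_def one_minus_def)

lemma gdelta_commute: "gdelta a b = gdelta b a"
  by (simp add: gdelta_def)

lemma finite_gsupp_one_minus [simp]: "finite (gsupp (one_minus a))"
  using finite_gsupp_lincomb[of "gdelta heis_one" "gdelta a" 1 "-1"] by (simp add: one_minus_def)

lemma pair_one_minus [simp]: "pair \<phi> (one_minus a) = \<phi> heis_one - \<phi> a"
  using pair_lincomb[of "gdelta heis_one" "gdelta a" \<phi> 1 "-1"] by (simp add: one_minus_def)

lemma gsupp_one_minus: "gsupp (one_minus a) \<subseteq> {heis_one, a}"
  by (auto simp: gsupp_def one_minus_def gdelta_def)

lemma augmentation_eq_pair: "augmentation f = pair (\<lambda>_. 1) f"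
  by (simp add: pair_const)

lemma one_minus_in_aug_ideal: "a \<in> heis_carrier n \<Longrightarrow> one_minus a \<in> aug_ideal n"
  using gsupp_one_minus[of a] by (auto simp: aug_ideal_def grp_alg_def augmentation_eq_pair)

lemma aug_ideal_scale:
  assumes "f \<in> aug_ideal n" shows "(\<lambda>x. c * f x) \<in> aug_ideal n"
proof -
  have fin: "finite (gsupp f)" using assms by (simp add: aug_ideal_def grp_alg_def)
  have "gsupp (\<lambda>x. c * f x) \<subseteq> gsupp f" by (auto simp: gsupp_def)
  moreover have "augmentation (\<lambda>x. c * f x) = c * augmentation f"
    unfolding augmentation_eq_pair using pair_lincomb[OF fin fin, of "\<lambda>_. 1" c 0] by simp
  ultimately show ?thesis using assms by (auto simp: aug_ideal_def grp_alg_def intro: finite_subset)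
qed

section \<open>The cube of the augmentation ideal\<close>

definition triple_products :: "nat \<Rightarrow> ((nat \<Rightarrow> int) \<Rightarrow> 'k::field) set" where
  "triple_products n = {conv n (conv n a b) c | a b c.
     a \<in> aug_ideal n \<and> b \<in> aug_ideal n \<and> c \<in> aug_ideal n}"

lemma cube_alt: "aug_ideal_cube n = {foldr (\<lambda>f g x. f x + g x) xs (\<lambda>_. 0) | xs. set xs \<subseteq> triple_products n}"
  unfolding aug_ideal_cube_def triple_products_def ..

lemma cube_zero: "(\<lambda>_. 0) \<in> aug_ideal_cube n"
  unfolding cube_alt by (rule CollectI, rule exI[of _ "[]"]) simp

lemma cube_add_triple:
  assumes "p \<in> triple_products n" "f \<in> aug_ideal_cube n"
  shows "(\<lambda>x. p x + f x) \<in> aug_ideal_cube n"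
proof -
  obtain xs where "f = foldr (\<lambda>f g x. f x + g x) xs (\<lambda>_. 0)" "set xs \<subseteq> triple_products n"
    using assms(2) unfolding cube_alt by blast
  then show ?thesis using assms(1) unfolding cube_alt by (intro CollectI exI[of _ "p # xs"]) simp
qed

text \<open>Hides the lists in the definition of \<open>aug_ideal_cube\<close>: elements are built
  by adding one triple product at a time.\<close>

lemma cube_induct [consumes 1, case_names zero add]:
  assumes "f \<in> aug_ideal_cube n" "Q (\<lambda>_. 0)"
    and "\<And>p f. p \<in> triple_products n \<Longrightarrow> f \<in> aug_ideal_cube n \<Longrightarrow> Q f \<Longrightarrow> Q (\<lambda>x. p x + f x)"
  shows "Q f"
proof -
  obtain xs where "f = foldr (\<lambda>f g x. f x + g x) xs (\<lambda>_. 0)" "set xs \<subseteq> triple_products n"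
    using assms(1) unfolding cube_alt by blast
  then show ?thesis
  proof (induction xs arbitrary: f)
    case Nil
    then show ?case using assms(2) by simp
  next
    case (Cons p xs)
    let ?g = "foldr (\<lambda>f g x. f x + g x) xs (\<lambda>_. 0)"
    have "?g \<in> aug_ideal_cube n" using Cons.prems(2) unfolding cube_alt by auto
    then show ?case using assms(3)[of p ?g] Cons.IH[OF refl] Cons.prems by simp
  qed
qed

lemma cube_add:
  assumes "f \<in> aug_ideal_cube n" "g \<in> aug_ideal_cube n"
  shows "(\<lambda>x. f x + g x) \<in> aug_ideal_cube n"
  using assms(1)
proof (induction rule: cube_induct)
  case zero
  then show ?case using assms(2) by simp
next
  case (add p f)
  then show ?case using cube_add_triple[OF add(1,3)] by (simp add: add.assoc)
qed

lemma aug_ideal_finite: "f \<in> aug_ideal n \<Longrightarrow> finite (gsupp f)"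
  by (simp add: aug_ideal_def grp_alg_def)

text \<open>The scalar is absorbed into the first factor; hence sums without coefficients already
  form a subspace.\<close>

lemma triple_products_scale:
  assumes "p \<in> triple_products n" shows "(\<lambda>x. c * p x) \<in> triple_products n"
proof -
  obtain f g h where p: "p = conv n (conv n f g) h" "f \<in> aug_ideal n" "g \<in> aug_ideal n" "h \<in> aug_ideal n"
    using assms unfolding triple_products_def by blast
  then have "(\<lambda>x. c * p x) = conv n (conv n (\<lambda>x. c * f x) g) h"
    by (simp add: conv_scale_left aug_ideal_finite finite_gsupp_conv)
  then show ?thesis unfolding triple_products_def using p aug_ideal_scale[of f n c] by blast
qed

lemma cube_scale:
  assumes "f \<in> aug_ideal_cube n" shows "(\<lambda>x. c * f x) \<in> aug_ideal_cube n"
  using assms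
proof (induction rule: cube_induct)
  case zero
  then show ?case by (simp add: cube_zero)
next
  case (add p f)
  then show ?case using cube_add_triple[OF triple_products_scale[OF add(1)] add(3)]
    by (simp add: distrib_left)
qed

lemma cube_lincomb:
  assumes "f \<in> aug_ideal_cube n" "g \<in> aug_ideal_cube n" "\<And>x. h x = a * f x + b * g x"
  shows "h \<in> aug_ideal_cube n"
proof -
  have "h = (\<lambda>x. a * f x + b * g x)" using assms(3) by blast
  then show ?thesis using cube_add[OF cube_scale[OF assms(1)] cube_scale[OF assms(2)]] by simp
qed

section \<open>Functions with vanishing third differences\<close>

definition quadratic :: "nat \<Rightarrow> ((nat \<Rightarrow> int) \<Rightarrow> 'k::field) \<Rightarrow> bool" where
  "quadratic n \<phi> \<longleftrightarrow> (\<forall>a\<in>heis_carrier n. \<forall>b\<in>heis_carrier n. \<forall>c\<in>heis_carrier n.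
     \<phi> (heis_mult n (heis_mult n a b) c) = \<phi> (heis_mult n a b) + \<phi> (heis_mult n a c)
       + \<phi> (heis_mult n b c) - \<phi> a - \<phi> b - \<phi> c + \<phi> heis_one)"

text \<open>The condition \<open>quadratic\<close> says that the linear extension of
  \<open>\<phi>\<close> kills (1 - a)(1 - b)(1 - c). It splits \<phi>(abc) into terms depending on
  at most two of the three variables.\<close>

lemma pair_triple_product:
  assumes "quadratic n \<phi>" "f \<in> aug_ideal n" "g \<in> aug_ideal n" "h \<in> aug_ideal n"
  shows "pair \<phi> (conv n (conv n f g) h) = 0"
proof -
  have sub: "gsupp f \<subseteq> heis_carrier n" "gsupp g \<subseteq> heis_carrier n" "gsupp h \<subseteq> heis_carrier n"
    and aug: "augmentation f = 0" "augmentation g = 0" "augmentation h = 0"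
    using assms(2-4) by (auto simp: aug_ideal_def grp_alg_def)
  \<comment> \<open>Each of the three groups omits one variable, and the factor belonging to that
    variable has augmentation 0.\<close>
  let ?A = "\<lambda>a b. \<phi> (heis_mult n a b) - \<phi> a - \<phi> b + \<phi> heis_one"
  let ?B = "\<lambda>a c. \<phi> (heis_mult n a c)"
  let ?C = "\<lambda>b c. \<phi> (heis_mult n b c) - \<phi> c"
  have "pair \<phi> (conv n (conv n f g) h) =
      pair (\<lambda>a. pair (\<lambda>b. pair (\<lambda>c. \<phi> (heis_mult n (heis_mult n a b) c)) h) g) f"
    using assms(2-4) by (simp add: pair_conv aug_ideal_finite finite_gsupp_conv)
  also have "\<dots> = pair (\<lambda>a. pair (\<lambda>b. pair (\<lambda>c. ?A a b + ?B a c + ?C b c) h) g) f"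
    using assms(1) sub by (intro pair_cong) (auto simp: quadratic_def subset_iff algebra_simps)
  also have "\<dots> = 0" by (simp add: pair_add_left pair_diff_left pair_const aug)
  finally show ?thesis .
qed

lemma cube_pair:
  assumes "f \<in> aug_ideal_cube n"
  shows "finite (gsupp f) \<and> (quadratic n \<phi> \<longrightarrow> pair \<phi> f = 0)"
  using assms
proof (induction rule: cube_induct)
  case zero
  then show ?case by (simp add: gsupp_def pair_def)
next
  case (add p f)
  obtain a b c where p: "p = conv n (conv n a b) c" "a \<in> aug_ideal n" "b \<in> aug_ideal n" "c \<in> aug_ideal n"
    using add(1) unfolding triple_products_def by blast
  then have "finite (gsupp p)" by (simp add: aug_ideal_finite finite_gsupp_conv)
  then show ?case
    using add(3) p pair_triple_product[of n \<phi> a b c]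
      pair_lincomb[of p f \<phi> 1 1] finite_gsupp_lincomb[of p f 1 1] by simp
qed

section \<open>Differences of group elements modulo the cube\<close>

lemma third_difference_in_cube:
  assumes "a \<in> heis_carrier n" "b \<in> heis_carrier n" "c \<in> heis_carrier n"
  shows "(\<lambda>x. gdelta heis_one x - gdelta a x - gdelta b x - gdelta c x
     + gdelta (heis_mult n a b) x + gdelta (heis_mult n a c) x + gdelta (heis_mult n b c) x
     - gdelta (heis_mult n (heis_mult n a b) c) x) \<in> aug_ideal_cube n" (is "?f \<in> _")
proof -
  \<comment> \<open>The alternating sum is (1 - a)(1 - b)(1 - c) multiplied out.\<close>
  have "?f = conv n (conv n (one_minus a) (one_minus b)) (one_minus c)"
    using assms
    by (intro ext) (simp add: conv_eq_pair[of "conv n _ _"] finite_gsupp_conv pair_conv gdelta_commute)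
  then have "?f \<in> triple_products n"
    unfolding triple_products_def using assms one_minus_in_aug_ideal by blast
  from cube_add_triple[OF this cube_zero] show ?thesis by simp
qed

text \<open>The product (g - 1)(h - 1) multiplied out. Modulo the cube it is additive in each
  argument.\<close>

definition second_diff :: "nat \<Rightarrow> (nat \<Rightarrow> int) \<Rightarrow> (nat \<Rightarrow> int) \<Rightarrow> (nat \<Rightarrow> int) \<Rightarrow> 'k::field" where
  "second_diff n g h = (\<lambda>x. gdelta (heis_mult n g h) x - gdelta g x - gdelta h x + gdelta heis_one x)"

text \<open>The combination equals (g - 1)(h - 1)(k - 1), the negative of the third difference;
  hence the coefficient \<open>-1\<close>.\<close>

lemma second_diff_mult_left:
  assumes "g \<in> heis_carrier n" "h \<in> heis_carrier n" "k \<in> heis_carrier n"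
  shows "(\<lambda>x. second_diff n (heis_mult n g h) k x - second_diff n g k x - second_diff n h k x)
    \<in> aug_ideal_cube n"
  using third_difference_in_cube[OF assms] cube_zero
  by (rule cube_lincomb[where a = "-1" and b = 0]) (simp add: second_diff_def)

lemma second_diff_mult_right:
  assumes "g \<in> heis_carrier n" "h \<in> heis_carrier n" "k \<in> heis_carrier n"
  shows "(\<lambda>x. second_diff n g (heis_mult n h k) x - second_diff n g h x - second_diff n g k x)
    \<in> aug_ideal_cube n"
  using third_difference_in_cube[OF assms] cube_zero
  by (rule cube_lincomb[where a = "-1" and b = 0]) (simp add: second_diff_def heis_mult_assoc)

text \<open>The relation [x, y] = z in the inverse-free form yxz = xy, for the first noncommuting
  pair of generators.\<close>

lemma heis_commutator:
  assumes "0 < n"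
  shows "heis_mult n (heis_mult n (heis_gen n) (heis_gen 0)) (heis_gen (2 * n))
    = heis_mult n (heis_gen 0) (heis_gen n)"
proof
  fix i
  have [simp]: "(\<Sum>j<n. (if j = 0 then 1 else 0) * (c j :: int)) = c 0" for c
  proof -
    have "(\<Sum>j<n. (if j = 0 then 1 else 0) * c j) = (\<Sum>j<n. if j = 0 then c j else 0)"
      by (rule sum.cong) auto
    then show ?thesis using assms by simp
  qed
  have [simp]: "(\<Sum>j<n. c j * (if j = n then 1 else 0)) = (0 :: int)"
    "(\<Sum>j<n. c j * (if j = 2 * n then 1 else 0)) = (0 :: int)" for c
    by (auto intro!: sum.neutral)
  show "heis_mult n (heis_mult n (heis_gen n) (heis_gen 0)) (heis_gen (2 * n)) i =
      heis_mult n (heis_gen 0) (heis_gen n) i"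
    using assms by (auto simp: heis_mult_def heis_gen_def)
qed

text \<open>Modulo the cube, the second difference is additive in its second argument,
  hence vanishes on the commutator \<open>x\<^sub>2\<^sub>n\<^sub>+\<^sub>1\<close>.\<close>

lemma second_diff_center:
  assumes "g \<in> heis_carrier n" "0 < n"
  shows "second_diff n g (heis_gen (2 * n)) \<in> aug_ideal_cube n"
proof -
  let ?x = "heis_gen 0" and ?y = "heis_gen n" and ?z = "heis_gen (2 * n)"
  let ?d = "second_diff n g"
  have cl: "?x \<in> heis_carrier n" "?y \<in> heis_carrier n" "?z \<in> heis_carrier n" by auto
  have "(\<lambda>x. ?d (heis_mult n ?x ?y) x - ?d (heis_mult n ?y ?x) x - ?d ?z x) \<in> aug_ideal_cube n"
    using second_diff_mult_right[OF assms(1) heis_mult_closed[of n ?y ?x] cl(3)]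
    unfolding heis_commutator[OF assms(2)] .
  \<comment> \<open>Additivity gives the same value on xy and on yx, namely the sum of the values on
    x and y.\<close>
  moreover have "(\<lambda>x. ?d (heis_mult n ?x ?y) x - ?d (heis_mult n ?y ?x) x) \<in> aug_ideal_cube n"
    by (rule cube_lincomb[OF second_diff_mult_right[OF assms(1) cl(1,2)]
          second_diff_mult_right[OF assms(1) cl(2,1)], where a = 1 and b = "-1"]) simp
  ultimately show ?thesis by (rule cube_lincomb[where a = "-1" and b = 1]) simp
qed

section \<open>The Jennings basis and its dual functionals\<close>

text \<open>Multiplication of a monomial by u_i, seen on exponent vectors.\<close>

definition jinc :: "nat \<Rightarrow> (nat \<Rightarrow> nat) \<Rightarrow> nat \<Rightarrow> nat" where
  "jinc i r = r(i := Suc (r i))"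

abbreviation jzero :: "nat \<Rightarrow> nat" where
  "jzero \<equiv> \<lambda>_. 0"

lemma jinc_neq_zero [simp]: "jinc i r \<noteq> jzero" "jzero \<noteq> jinc i r"
  by (auto simp: jinc_def fun_eq_iff)

lemma jinc_zero_inject [simp]: "jinc i jzero = jinc j jzero \<longleftrightarrow> i = j"
  by (auto simp: jinc_def fun_eq_iff)

text \<open>Splits off the first factor of an ordered monomial: \<open>i\<close> is the least index
  with nonzero exponent.\<close>

lemma jinc_decompose:
  assumes "r \<noteq> jzero" "\<forall>k>2*n. r k = 0"
  obtains i r' where "i \<le> 2 * n" "r = jinc i r'" "\<forall>j<i. r' j = 0" "\<forall>k>2*n. r' k = 0"
proof -
  define i where "i = (LEAST i. r i \<noteq> 0)"
  have "\<exists>i. r i \<noteq> 0" using assms(1) by auto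
  then have i: "r i \<noteq> 0" "\<And>j. j < i \<Longrightarrow> r j = 0"
    unfolding i_def by (rule LeastI_ex, use not_less_Least in blast)
  then have "i \<le> 2 * n" using assms(2) by (meson leI)
  moreover have "r = jinc i (r(i := r i - 1))" using i(1) by (auto simp: jinc_def)
  ultimately show thesis using that i(2) assms(2) by simp
qed

lemma sum_jinc: "(\<Sum>k<m. jinc i r k) = (\<Sum>k<m. r k) + (if i < m then 1 else 0)"
proof -
  have "jinc i r k = r k + (if k = i then 1 else 0)" for k by (simp add: jinc_def)
  then show ?thesis by (simp add: sum.distrib)
qed

lemma jbasis_cases:
  assumes "r \<in> jbasis n"
  obtains "r = jzero" | i where "i \<le> 2 * n" "r = jinc i jzero"
  | i j where "i \<le> j" "j < 2 * n" "r = jinc i (jinc j jzero)"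
proof (cases "r = jzero")
  case True
  then show thesis using that by blast
next
  case False
  have out: "\<forall>k>2*n. r k = 0" and wt: "(\<Sum>i<2*n. r i) + 2 * r (2*n) \<le> 2"
    using assms by (auto simp: jbasis_def)
  obtain i r' where i: "i \<le> 2 * n" "r = jinc i r'" "\<forall>j<i. r' j = 0" "\<forall>k>2*n. r' k = 0"
    using jinc_decompose[OF False out] by blast
  show thesis
  proof (cases "r' = jzero")
    case True
    then show thesis using that i by blast
  next
    case False
    obtain j r'' where j: "j \<le> 2 * n" "r' = jinc j r''" "\<forall>k>2*n. r'' k = 0"
      using jinc_decompose[OF False i(4)] by blast
    have "i \<le> j" using i(3) j(2) by (metis Suc_neq_Zero fun_upd_same jinc_def leI)
    \<comment> \<open>The weight bound after splitting off two factors. A central factor counts 2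
      and the other at least 1, so both are noncentral and nothing is left for
      \<open>r''\<close>.\<close>
    have wt': "(\<Sum>k<2*n. r'' k) + (if j < 2*n then 1 else 0) + (if i < 2*n then 1 else 0)
        + 2 * (r'' (2*n) + (if j = 2*n then 1 else 0) + (if i = 2*n then 1 else 0)) \<le> 2"
      using wt unfolding i(2) j(2) sum_jinc by (simp add: jinc_def split: if_splits)
    then have "j < 2 * n" "i < 2 * n" using i(1) j(1) by (auto split: if_splits)
    then have "(\<Sum>k<2*n. r'' k) = 0" "r'' (2*n) = 0" using wt' by auto
    then have "r'' k = 0" for k using j(3) by (cases k "2 * n" rule: linorder_cases) auto
    then have "r'' = jzero" by blast
    then show thesis using that i j \<open>i \<le> j\<close> \<open>j < 2 * n\<close> by blast
  qed
qed

lemma jzero_in_jbasis [simp]: "jzero \<in> jbasis n"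
  by (simp add: jbasis_def)

lemma jinc_in_jbasis [simp]: "i \<le> 2 * n \<Longrightarrow> jinc i jzero \<in> jbasis n"
  by (auto simp: jbasis_def sum_jinc) (auto simp: jinc_def)

lemma jinc_jinc_in_jbasis: "i < 2 * n \<Longrightarrow> j < 2 * n \<Longrightarrow> jinc i (jinc j jzero) \<in> jbasis n"
  by (auto simp: jbasis_def sum_jinc) (auto simp: jinc_def)

lemma jbasis_outside: "r \<in> jbasis n \<Longrightarrow> \<forall>k>2*n. r k = 0"
  by (auto simp: jbasis_def)

lemma finite_jbasis: "finite (jbasis n)"
proof (rule finite_subset)
  show "jbasis n \<subseteq> {jzero} \<union> (\<lambda>i. jinc i jzero) ` {..2*n} \<union>
      (\<lambda>(i, j). jinc i (jinc j jzero)) ` ({..2*n} \<times> {..2*n})"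
  proof
    fix r assume "r \<in> jbasis n"
    then show "r \<in> {jzero} \<union> (\<lambda>i. jinc i jzero) ` {..2*n} \<union>
      (\<lambda>(i, j). jinc i (jinc j jzero)) ` ({..2*n} \<times> {..2*n})"
    proof (cases rule: jbasis_cases)
      case (3 i j)
      then show ?thesis by (intro UnI2 image_eqI[of _ _ "(i, j)"]) auto
    qed auto
  qed
qed auto

lemma jbelem_zero: "jbelem n jzero = gdelta heis_one"
proof -
  have "concat (map (\<lambda>i. replicate (0::nat) (uu i :: _ \<Rightarrow> 'a)) [0..<2*n+1]) = []"
    by (simp del: upt_Suc)
  then show ?thesis unfolding jbelem_def by (simp only: foldr.simps id_apply)
qed

text \<open>The factors of \<open>jbelem\<close> are listed by increasing index, so when no smaller
  index occurs the new factor stands in front.\<close>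

lemma jbelem_jinc:
  assumes "i \<le> 2 * n" "\<forall>j<i. r j = 0"
  shows "jbelem n (jinc i r) = conv n (uu i) (jbelem n r)"
proof -
  have split: "[0..<2*n+1] = [0..<i] @ i # [Suc i..<2*n+1]"
    using assms(1) upt_add_eq_append[of 0 i "2 * n + 1 - i"] by (simp add: upt_conv_Cons del: upt_Suc)
  have low: "concat (map (\<lambda>k. replicate (q k) (uu k)) [0..<i]) = []" if "\<forall>j<i. q j = 0" for q
    using that by simp
  have high: "map (\<lambda>k. replicate (jinc i r k) (uu k)) [Suc i..<2*n+1] = map (\<lambda>k. replicate (r k) (uu k)) [Suc i..<2*n+1]"
    by (rule map_cong) (auto simp: jinc_def)
  have "\<forall>j<i. jinc i r j = 0" using assms(2) by (simp add: jinc_def)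
  then have "concat (map (\<lambda>k. replicate (jinc i r k) (uu k)) [0..<2*n+1]) =
      uu i # concat (map (\<lambda>k. replicate (r k) (uu k :: _ \<Rightarrow> 'a)) [0..<2*n+1])"
    unfolding split map_append concat_append list.map concat.simps low[OF assms(2)] high
    by (subst low) (simp_all add: jinc_def del: upt_Suc)
  then show ?thesis unfolding jbelem_def by (simp only: foldr.simps o_apply)
qed

text \<open>The coefficient of \<open>u^s\<close> in \<open>x^v\<close>, expanded by \<open>x\<^sub>i^a = (1 - u\<^sub>i)^a\<close>.\<close>

definition jdual :: "nat \<Rightarrow> (nat \<Rightarrow> nat) \<Rightarrow> (nat \<Rightarrow> int) \<Rightarrow> 'k::field_char_0" where
  "jdual n s v = (\<Prod>i\<le>2*n. (-1) ^ s i * (of_int (v i) gchoose s i))"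

lemma jdual_remove:
  assumes "i \<le> 2 * n"
  shows "jdual n s v = (-1) ^ s i * (of_int (v i) gchoose s i) *
    (\<Prod>k\<in>{..2*n} - {i}. (-1) ^ s k * (of_int (v k) gchoose s k))"
  unfolding jdual_def by (rule prod.remove) (use assms in auto)

lemma jdual_update:
  assumes "i \<le> 2 * n" "r i = 0"
  shows "jdual n (r(i := k)) v = (-1) ^ k * (of_int (v i) gchoose k) * jdual n r v"
proof -
  have "(\<Prod>l\<in>{..2*n} - {i}. (-1) ^ (r(i := k)) l * (of_int (v l) gchoose (r(i := k)) l)) =
     (\<Prod>l\<in>{..2*n} - {i}. (-1) ^ r l * (of_int (v l) gchoose r l) :: 'a)"
    by (rule prod.cong) auto
  then show ?thesis using assms by (simp add: jdual_remove[of i])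
qed

lemma jdual_zero [simp]: "jdual n jzero v = 1"
  by (simp add: jdual_def)

lemma jdual_one: "i \<le> 2 * n \<Longrightarrow> jdual n (jinc i jzero) v = - of_int (v i)"
  by (simp add: jinc_def jdual_update)

lemma jdual_two:
  assumes "i \<le> 2 * n" "j \<le> 2 * n"
  shows "jdual n (jinc i (jinc j jzero)) v =
    (if i = j then of_int (v i) * (of_int (v i) - 1) / 2 else of_int (v i) * of_int (v j))"
proof (cases "i = j")
  case True
  have "jinc i (jinc i jzero) = jzero(i := 2)" by (auto simp: jinc_def)
  then show ?thesis using True assms
    by (simp add: jdual_update gbinomial_prod_rev numeral_2_eq_2 lessThan_Suc)
next
  case False
  have "jinc i (jinc j jzero) = (jinc j jzero)(i := 1)" "jinc j jzero i = 0"
    using False by (auto simp: jinc_def)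
  then show ?thesis using False assms by (simp add: jdual_update jdual_one)
qed

section \<open>Duality of the binomial functions and the basis\<close>

lemma jdual_heis_one:
  assumes "\<forall>k>2*n. s k = 0"
  shows "jdual n s heis_one = of_bool (s = jzero)"
proof (cases "s = jzero")
  case False
  then obtain i where "s i \<noteq> 0" by auto
  then have "i \<le> 2 * n" using assms by (meson leI)
  then show ?thesis using False \<open>s i \<noteq> 0\<close> by (simp add: jdual_remove[of i] heis_one_def gbinomial_0_left)
qed simp

text \<open>Pascal's rule; the signs in \<open>jdual\<close> turn the difference into the function
  with \<open>s i\<close> lowered by one.\<close>

lemma jdual_increment:
  assumes "i \<le> 2 * n"
  shows "jdual n s v - jdual n s (v(i := v i + 1)) = (if s i = 0 then 0 else jdual n (s(i := s i - 1)) v)"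
proof -
  let ?R = "\<Prod>k\<in>{..2*n} - {i}. (-1) ^ s k * (of_int (v k) gchoose s k) :: 'a"
  have R: "(\<Prod>k\<in>{..2*n} - {i}. (-1) ^ s k * (of_int ((v(i := v i + 1)) k) gchoose s k)) = ?R"
    "(\<Prod>k\<in>{..2*n} - {i}. (-1) ^ (s(i := s i - 1)) k * (of_int (v k) gchoose (s(i := s i - 1)) k)) = ?R"
    by (auto intro!: prod.cong)
  show ?thesis
  proof (cases "s i")
    case 0
    then show ?thesis unfolding jdual_remove[OF assms] R by simp
  next
    case (Suc m)
    then show ?thesis unfolding jdual_remove[OF assms] R
      using gbinomial_Suc_Suc[of "of_int (v i) :: 'a" m] by (simp add: algebra_simps)
  qed
qed

text \<open>The inductive step of duality: by Pascal's rule, multiplying by u_i = 1 - x_i replaces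
  the functional \<open>s\<close> by \<open>s\<close> lowered at \<open>i\<close>. The support of
  \<open>f\<close> vanishes below \<open>i\<close>, so left multiplication by x_i only raises
  coordinate \<open>i\<close>.\<close>

lemma pair_jdual_conv_uu:
  assumes "i \<le> 2 * n" "finite (gsupp f)" "gsupp f \<subseteq> heis_carrier n"
    and "\<And>v j. v \<in> gsupp f \<Longrightarrow> j < i \<Longrightarrow> v j = 0"
    and "\<And>s. \<forall>k>2*n. s k = 0 \<Longrightarrow> pair (jdual n s) f = of_bool (s = r)"
    and "\<forall>k>2*n. s k = 0"
  shows "pair (jdual n s) (conv n (uu i) f) = of_bool (s = jinc i r)"
proof -
  have "pair (jdual n s) (conv n (uu i) f) =
      pair (\<lambda>v. jdual n s (heis_mult n heis_one v)) f - pair (\<lambda>v. jdual n s (heis_mult n (heis_gen i) v)) f"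
    using assms(2) by (simp add: uu_eq_one_minus pair_conv)
  also have "\<dots> = pair (\<lambda>v. jdual n s (heis_mult n heis_one v) - jdual n s (heis_mult n (heis_gen i) v)) f"
    by (simp add: pair_diff_left)
  also have "\<dots> = pair (\<lambda>v. if s i = 0 then 0 else jdual n (s(i := s i - 1)) v) f"
  proof (rule pair_cong)
    fix v assume v: "v \<in> gsupp f"
    then have "v \<in> heis_carrier n" using assms(3) by blast
    then show "jdual n s (heis_mult n heis_one v) - jdual n s (heis_mult n (heis_gen i) v) =
      (if s i = 0 then 0 else jdual n (s(i := s i - 1)) v)"
      using jdual_increment[OF assms(1), of s v] heis_mult_gen_left[OF _ assms(4)[OF v] assms(1)]
      by simp
  qed
  also have "\<dots> = of_bool (s = jinc i r)"
  proof (cases "s i = 0")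
    case True
    then have "s \<noteq> jinc i r" by (auto simp: jinc_def)
    then show ?thesis using True by (simp add: pair_const)
  next
    case False
    then have "s(i := s i - 1) = r \<longleftrightarrow> s = jinc i r" by (auto simp: jinc_def)
    then show ?thesis using False assms(5)[of "s(i := s i - 1)"] assms(6) by simp
  qed
  finally show ?thesis .
qed

lemma jbelem_one:
  assumes "j \<le> 2 * n"
  shows "jbelem n (jinc j jzero) = one_minus (heis_gen j)"
proof
  fix x
  have "conv n (one_minus (heis_gen j)) (gdelta heis_one) x = gdelta heis_one x - gdelta (heis_gen j) x"
    using assms by (subst conv_eq_pair) (simp_all add: gdelta_commute[of x])
  then show "jbelem n (jinc j jzero) x = one_minus (heis_gen j) x"
    using assms by (simp add: jbelem_jinc jbelem_zero uu_eq_one_minus one_minus_def)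
qed

lemma jbelem_two:
  assumes "i \<le> j" "j \<le> 2 * n"
  shows "jbelem n (jinc i (jinc j jzero)) = conv n (uu i) (one_minus (heis_gen j))"
  using assms by (simp add: jbelem_jinc[of i] jinc_def[of j] flip: jbelem_one)

lemma finite_gsupp_jbelem:
  assumes "r \<in> jbasis n" shows "finite (gsupp (jbelem n r))"
  using assms
proof (cases rule: jbasis_cases)
  case (3 i j)
  then show ?thesis by (simp add: jbelem_two uu_eq_one_minus finite_gsupp_conv)
qed (auto simp: jbelem_zero jbelem_one)

lemma pair_jdual_jbelem:
  assumes "r \<in> jbasis n" "\<forall>k>2*n. s k = 0"
  shows "pair (jdual n s) (jbelem n r) = (of_bool (s = r) :: 'a::field_char_0)"
proof -
  have zero: "pair (jdual n s) (gdelta heis_one) = (of_bool (s = jzero) :: 'a)" if "\<forall>k>2*n. s k = 0" for s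
    using jdual_heis_one[OF that] by simp
  have one: "pair (jdual n s) (one_minus (heis_gen j)) = (of_bool (s = jinc j jzero) :: 'a)"
    if "j \<le> 2 * n" "\<forall>k>2*n. s k = 0" for s j
  proof -
    have "pair (jdual n s) (conv n (uu j) (gdelta heis_one)) = (of_bool (s = jinc j jzero) :: 'a)"
      by (rule pair_jdual_conv_uu) (use that zero in \<open>auto simp: jdual_heis_one\<close>, simp add: heis_one_def)
    then show ?thesis using that by (simp add: jbelem_jinc jbelem_zero flip: jbelem_one)
  qed
  show ?thesis using assms(1)
  proof (cases rule: jbasis_cases)
    case 1
    then show ?thesis using zero assms(2) by (simp add: jbelem_zero)
  next
    case (2 i)
    then show ?thesis using one assms(2) by (simp add: jbelem_one)
  next
    case (3 i j)
    have "pair (jdual n s) (conv n (uu i) (one_minus (heis_gen j))) =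
        (of_bool (s = jinc i (jinc j jzero)) :: 'a)"
    proof (rule pair_jdual_conv_uu)
      show "gsupp (one_minus (heis_gen j) :: _ \<Rightarrow> 'a) \<subseteq> heis_carrier n"
        using gsupp_one_minus[of "heis_gen j"] heis_gen_closed[of j n] 3 by auto
      show "v k = 0" if "v \<in> gsupp (one_minus (heis_gen j) :: _ \<Rightarrow> 'a)" "k < i" for v k
        using gsupp_one_minus[of "heis_gen j"] that 3 by (auto simp: heis_one_def heis_gen_def)
    qed (use 3 one assms(2) in auto)
    then show ?thesis using 3 by (simp add: jbelem_two)
  qed
qed

text \<open>Noncentral coordinates are additive, so products of two of them are quadratic; the
  central coordinate is additive up to a bilinear term.\<close>

lemma quadratic_jdual:
  assumes "s \<in> jbasis n" "0 < n" shows "quadratic n (jdual n s)"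
  using assms(1)
proof (cases rule: jbasis_cases)
  case 1
  then show ?thesis by (simp add: quadratic_def)
next
  case (2 i)
  show ?thesis
  proof (cases "i = 2 * n")
    case True
    then show ?thesis using 2
      by (simp add: quadratic_def jdual_one heis_mult_def heis_one_def algebra_simps sum.distrib)
  next
    case False
    then show ?thesis using 2
      by (simp add: quadratic_def jdual_one heis_mult_def heis_one_def)
  qed
next
  case (3 i j)
  then show ?thesis
    by (auto simp: quadratic_def jdual_two heis_mult_def heis_one_def field_simps)
qed

section \<open>The Jennings coefficients\<close>

definition jspan :: "nat \<Rightarrow> ((nat \<Rightarrow> int) \<Rightarrow> 'k::field) set" where
  "jspan n = {f. \<exists>c. (\<lambda>x. f x - (\<Sum>t\<in>jbasis n. c t * jbelem n t x)) \<in> aug_ideal_cube n}"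

lemma jspan_lincomb:
  assumes "f \<in> jspan n" "g \<in> jspan n" "\<And>x. h x = a * f x + b * g x"
  shows "h \<in> jspan n"
proof -
  obtain c d where c: "(\<lambda>x. f x - (\<Sum>t\<in>jbasis n. c t * jbelem n t x)) \<in> aug_ideal_cube n"
    and d: "(\<lambda>x. g x - (\<Sum>t\<in>jbasis n. d t * jbelem n t x)) \<in> aug_ideal_cube n"
    using assms(1,2) unfolding jspan_def by blast
  have "(\<lambda>x. h x - (\<Sum>t\<in>jbasis n. (a * c t + b * d t) * jbelem n t x)) \<in> aug_ideal_cube n"
    by (rule cube_lincomb[OF c d, where a = a and b = b])
      (simp add: assms(3) algebra_simps sum.distrib sum_distrib_left)
  then show ?thesis unfolding jspan_def by (intro CollectI exI[of _ "\<lambda>t. a * c t + b * d t"])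
qed

lemma cube_subset_jspan:
  assumes "f \<in> aug_ideal_cube n" shows "f \<in> jspan n"
  unfolding jspan_def by (rule CollectI, rule exI[of _ "\<lambda>_. 0"]) (simp add: assms)

lemma jbelem_in_jspan:
  assumes "r \<in> jbasis n" shows "jbelem n r \<in> jspan n"
proof -
  have "(\<Sum>t\<in>jbasis n. of_bool (t = r) * jbelem n t x) = (jbelem n r x :: 'a)" for x
  proof -
    have "(\<Sum>t\<in>jbasis n. of_bool (t = r) * jbelem n t x) = (\<Sum>t\<in>jbasis n. if t = r then jbelem n t x else (0 :: 'a))"
      by (rule sum.cong) auto
    then show ?thesis using assms finite_jbasis[of n] by simp
  qed
  then show ?thesis unfolding jspan_def
    by (intro CollectI exI[of _ "\<lambda>t. of_bool (t = r)"]) (simp add: cube_zero)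
qed

lemma gdelta_one_in_jspan: "gdelta heis_one \<in> jspan n"
  using jbelem_in_jspan[of jzero n] by (simp add: jbelem_zero)

lemma gdelta_gen_in_jspan:
  assumes "i \<le> 2 * n" shows "gdelta (heis_gen i) \<in> jspan n"
proof -
  have "one_minus (heis_gen i) \<in> jspan n"
    using jbelem_in_jspan[of "jinc i jzero" n] assms by (simp add: jbelem_one)
  from gdelta_one_in_jspan this show ?thesis
    by (rule jspan_lincomb[where a = 1 and b = "-1"]) (simp add: one_minus_def)
qed

lemma second_diff_gen_in_jspan:
  assumes "i \<le> j" "j < 2 * n" shows "(second_diff n (heis_gen i) (heis_gen j) :: _ \<Rightarrow> 'a::field) \<in> jspan n"
proof -
  have "conv n (uu i) (one_minus (heis_gen j)) = (second_diff n (heis_gen i) (heis_gen j) :: _ \<Rightarrow> 'a)"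
  proof
    fix x
    show "conv n (uu i) (one_minus (heis_gen j)) x = (second_diff n (heis_gen i) (heis_gen j) x :: 'a)"
      unfolding uu_eq_one_minus using assms
      by (subst conv_eq_pair) (simp_all add: gdelta_commute[of x] second_diff_def)
  qed
  then show ?thesis
    using jbelem_in_jspan[OF jinc_jinc_in_jbasis[of i n j], where 'a = 'a] assms by (simp add: jbelem_two)
qed

text \<open>For central x_j the element (v - 1)(x_j - 1) lies in the cube. Otherwise, by additivity
  on the left, building up \<open>v\<close> adds or subtracts elements (x_i - 1)(x_j - 1) with i
  \<le> j, which are basis elements.\<close>

lemma second_diff_last_in_jspan:
  assumes "j \<le> 2 * n" "0 < n" "\<And>i. i > j \<Longrightarrow> v i = 0"
  shows "(second_diff n v (heis_gen j) :: _ \<Rightarrow> 'a::field) \<in> jspan n"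
proof (cases "j = 2 * n")
  case True
  have "v \<in> heis_carrier n" using assms(3) True by (simp add: heis_carrier_mem)
  then show ?thesis using True second_diff_center assms(2) cube_subset_jspan by blast
next
  case False
  show ?thesis
  proof (rule malcev_induct[of "\<lambda>v. (second_diff n v (heis_gen j) :: _ \<Rightarrow> 'a) \<in> jspan n" "Suc j" v])
    have "second_diff n heis_one (heis_gen j) = (\<lambda>_. 0 :: 'a)"
      using assms(1) by (simp add: second_diff_def fun_eq_iff)
    then show "(second_diff n (\<lambda>_. 0) (heis_gen j) :: _ \<Rightarrow> 'a) \<in> jspan n"
      by (simp add: heis_one_def cube_subset_jspan cube_zero)
  next
    fix i v assume i: "i < Suc j" and v: "\<And>k. k > i \<Longrightarrow> v k = (0::int)"
    have vc: "v \<in> heis_carrier n" using i v assms(1) by (auto simp: heis_carrier_mem)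
    have ic: "heis_gen i \<in> heis_carrier n" "heis_gen j \<in> heis_carrier n" using i assms(1) by auto
    have eq: "v(i := v i + 1) = heis_mult n v (heis_gen i)"
      using heis_mult_gen_right[OF vc v] i assms(1,2) by simp
    have base: "(second_diff n (heis_gen i) (heis_gen j) :: _ \<Rightarrow> 'a) \<in> jspan n"
      using i assms(1) False by (intro second_diff_gen_in_jspan) auto
    note diff = cube_subset_jspan[OF second_diff_mult_left[OF vc ic]]
    note sum = jspan_lincomb[OF diff base, where a = 1 and b = 1, OF refl]
    show "(second_diff n (v(i := v i + 1)) (heis_gen j) :: _ \<Rightarrow> 'a) \<in> jspan n \<longleftrightarrow> (second_diff n v (heis_gen j) :: _ \<Rightarrow> 'a) \<in> jspan n"
      unfolding eq
    proof
      assume "(second_diff n (heis_mult n v (heis_gen i)) (heis_gen j) :: _ \<Rightarrow> 'a) \<in> jspan n"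
      from this sum show "(second_diff n v (heis_gen j) :: _ \<Rightarrow> 'a) \<in> jspan n"
        by (rule jspan_lincomb[where a = 1 and b = "-1"]) simp
    next
      assume "(second_diff n v (heis_gen j) :: _ \<Rightarrow> 'a) \<in> jspan n"
      from this sum show "(second_diff n (heis_mult n v (heis_gen i)) (heis_gen j) :: _ \<Rightarrow> 'a) \<in> jspan n"
        by (rule jspan_lincomb[where a = 1 and b = 1]) simp
    qed
  qed (use assms in auto)
qed

text \<open>Mal'cev induction with the identity v x_j = v + (x_j - 1) + (v - 1)(x_j - 1), whose last
  two terms are already in the span.\<close>

lemma gdelta_in_jspan:
  assumes "v \<in> heis_carrier n" "0 < n"
  shows "(gdelta v :: _ \<Rightarrow> 'a::field) \<in> jspan n"
proof (rule malcev_induct[of "\<lambda>v. (gdelta v :: _ \<Rightarrow> 'a) \<in> jspan n" "Suc (2 * n)" v])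
  show "(gdelta (\<lambda>_. 0) :: _ \<Rightarrow> 'a) \<in> jspan n" using gdelta_one_in_jspan by (simp add: heis_one_def)
next
  fix j v assume j: "j < Suc (2 * n)" and v: "\<And>k. k > j \<Longrightarrow> v k = (0::int)"
  have vc: "v \<in> heis_carrier n" using j v by (auto simp: heis_carrier_mem)
  have eq: "v(j := v j + 1) = heis_mult n v (heis_gen j)"
    using heis_mult_gen_right[OF vc v] j assms(2) by simp
  have jle: "j \<le> 2 * n" using j by simp
  have d: "(second_diff n v (heis_gen j) :: _ \<Rightarrow> 'a) \<in> jspan n"
    using second_diff_last_in_jspan[OF jle assms(2)] v by blast
  have e: "(\<lambda>x. gdelta (heis_gen j) x - gdelta heis_one x :: 'a) \<in> jspan n"
    by (rule jspan_lincomb[OF gdelta_gen_in_jspan[OF jle] gdelta_one_in_jspan, where a = 1 and b = "-1"]) simp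
  note sum = jspan_lincomb[OF d e, where a = 1 and b = 1, OF refl]
  show "(gdelta (v(j := v j + 1)) :: _ \<Rightarrow> 'a) \<in> jspan n \<longleftrightarrow> (gdelta v :: _ \<Rightarrow> 'a) \<in> jspan n" unfolding eq
  proof
    assume "(gdelta (heis_mult n v (heis_gen j)) :: _ \<Rightarrow> 'a) \<in> jspan n"
    from this sum show "(gdelta v :: _ \<Rightarrow> 'a) \<in> jspan n"
      by (rule jspan_lincomb[where a = 1 and b = "-1"]) (simp add: second_diff_def)
  next
    assume "(gdelta v :: _ \<Rightarrow> 'a) \<in> jspan n"
    from this sum show "(gdelta (heis_mult n v (heis_gen j)) :: _ \<Rightarrow> 'a) \<in> jspan n"
      by (rule jspan_lincomb[where a = 1 and b = 1]) (simp add: second_diff_def)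
  qed
next
  show "v i = 0" if "i \<ge> Suc (2 * n)" for i using assms(1) that by (auto simp: heis_carrier_mem)
qed

lemma grp_alg_subset_jspan:
  assumes "f \<in> grp_alg n" "0 < n"
  shows "f \<in> jspan n"
proof -
  have fin: "finite (gsupp f)" and sub: "gsupp f \<subseteq> heis_carrier n"
    using assms(1) by (auto simp: grp_alg_def)
  have "(\<lambda>x. \<Sum>y\<in>A. f y * gdelta y x) \<in> jspan n" if "finite A" "A \<subseteq> heis_carrier n" for A
    using that
  proof (induction A)
    case empty
    then show ?case by (simp add: cube_subset_jspan cube_zero)
  next
    case (insert y A)
    then have "gdelta y \<in> jspan n" "(\<lambda>x. \<Sum>y\<in>A. f y * gdelta y x) \<in> jspan n"
      using gdelta_in_jspan assms(2) by auto
    then show ?case by (rule jspan_lincomb[where a = "f y" and b = 1]) (use insert in simp)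
  qed
  from this[OF fin sub] have "(\<lambda>x. \<Sum>y\<in>gsupp f. f y * gdelta y x) \<in> jspan n" .
  moreover have "(\<lambda>x. \<Sum>y\<in>gsupp f. f y * gdelta y x) = f"
  proof
    fix x
    have "(\<Sum>y\<in>gsupp f. f y * gdelta y x) = (\<Sum>y\<in>gsupp f. if y = x then f y else 0)"
      by (rule sum.cong) (auto simp: gdelta_def)
    then show "(\<Sum>y\<in>gsupp f. f y * gdelta y x) = f x" using fin by (simp add: gsupp_def)
  qed
  ultimately show ?thesis by (simp only:)
qed

text \<open>Spanning gives existence of the coefficients. The dual functionals kill the cube and
  read off each coefficient, which gives uniqueness and the formula, so the \<open>THE\<close> in
  \<open>jcoef\<close> is well defined.\<close>

lemma jcoef_eq_pair:
  fixes K :: "'k::field_char_0 itself"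
  assumes "0 < n" "g \<in> heis_carrier n" "r \<in> jbasis n" "t \<in> jbasis n"
  shows "jcoef K n g r t = pair (\<lambda>v. jdual n t (heis_mult n v g)) (jbelem n r)"
proof -
  let ?f = "conv n (jbelem n r) (gdelta g) :: _ \<Rightarrow> 'k"
  let ?P = "\<lambda>c :: (nat \<Rightarrow> nat) \<Rightarrow> 'k. (\<forall>t. t \<notin> jbasis n \<longrightarrow> c t = 0) \<and>
      (\<lambda>x. ?f x - (\<Sum>t\<in>jbasis n. c t * jbelem n t x)) \<in> aug_ideal_cube n"
  have fin: "finite (gsupp ?f)" using assms(3) by (simp add: finite_gsupp_conv finite_gsupp_jbelem)
  have unique: "c t = pair (jdual n t) ?f" if c: "?P c" and t: "t \<in> jbasis n" for c t
  proof -
    let ?g = "\<lambda>x. \<Sum>t\<in>jbasis n. c t * jbelem n t x"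
    have g: "finite (gsupp ?g)" "pair (jdual n t) ?g = (\<Sum>s\<in>jbasis n. c s * pair (jdual n t) (jbelem n s))"
      using pair_sum[of "jbasis n" "jbelem n" c "jdual n t"] finite_gsupp_jbelem by auto
    have "pair (jdual n t) ?g = (\<Sum>s\<in>jbasis n. if s = t then c s else 0)"
      unfolding g(2) by (rule sum.cong) (use t in \<open>auto simp: pair_jdual_jbelem jbasis_outside\<close>)
    also have "\<dots> = c t" using t finite_jbasis by simp
    finally have "pair (jdual n t) (\<lambda>x. 1 * ?f x + (-1) * ?g x) = pair (jdual n t) ?f - c t"
      unfolding pair_lincomb[OF fin g(1)] by simp
    moreover have "pair (jdual n t) (\<lambda>x. ?f x - ?g x) = 0"
      using cube_pair[of "\<lambda>x. ?f x - ?g x"] c quadratic_jdual[OF t assms(1)] by blast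
    ultimately show ?thesis by simp
  qed
  have "?f \<in> grp_alg n"
    using fin gsupp_conv[of n "jbelem n r" "gdelta g"] by (auto simp: grp_alg_def)
  then obtain c0 where c0: "(\<lambda>x. ?f x - (\<Sum>t\<in>jbasis n. c0 t * jbelem n t x)) \<in> aug_ideal_cube n"
    using grp_alg_subset_jspan[OF _ assms(1)] unfolding jspan_def by blast
  \<comment> \<open>\<open>jcoef\<close> describes a function that is 0 off the basis, so the
    arbitrary values of \<open>c0\<close> there are cleared.\<close>
  define c where "c = (\<lambda>t. if t \<in> jbasis n then c0 t else 0)"
  have "(\<Sum>t\<in>jbasis n. c t * jbelem n t x) = (\<Sum>t\<in>jbasis n. c0 t * jbelem n t x)" for x
    by (rule sum.cong) (auto simp: c_def)
  then have c: "?P c" using c0 by (simp add: c_def)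
  have "jcoef K n g r = c" unfolding jcoef_def
  proof (rule the_equality)
    fix c' assume c': "?P c'"
    show "c' = c"
    proof
      fix t show "c' t = c t" using unique[OF c] unique[OF c'] c c' by (cases "t \<in> jbasis n") auto
    qed
  qed (rule c)
  then show ?thesis using unique[OF c assms(4)] assms(3)
    by (simp add: pair_conv finite_gsupp_jbelem)
qed

section \<open>Explicit entries of the Jennings matrices\<close>

lemma pair_jbelem:
  assumes "r \<in> jbasis n" "t \<in> jbasis n"
  shows "pair (jdual n t) (jbelem n r) = of_bool (r = t)"
  using pair_jdual_jbelem[OF assms(1) jbasis_outside[OF assms(2)]] eq_commute[of t r] by (simp only:)

lemma pair_one_jbelem:
  assumes "r \<in> jbasis n"
  shows "pair (\<lambda>_. 1) (jbelem n r) = (of_bool (r = jzero) :: 'k::field_char_0)"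
proof -
  have "jdual n jzero = (\<lambda>_. 1 :: 'k)" by (simp add: fun_eq_iff)
  then show ?thesis using pair_jbelem[OF assms jzero_in_jbasis, where 'a = 'k] by simp
qed

lemma jcoef_linear:
  fixes K :: "'k::field_char_0 itself"
  assumes "0 < n" "g \<in> heis_carrier n" "r \<in> jbasis n" "i < 2 * n"
  shows "jcoef K n g r (jinc i jzero) = of_int (of_bool (r = jinc i jzero) - of_bool (r = jzero) * g i)"
proof -
  have "jcoef K n g r (jinc i jzero) =
      pair (\<lambda>v. jdual n (jinc i jzero) v - of_int (g i) * jdual n jzero v) (jbelem n r)"
    using assms by (simp add: jcoef_eq_pair jdual_one heis_mult_def)
  then show ?thesis using assms
    by (simp only: pair_diff_left pair_scale_left) (simp add: pair_jbelem pair_one_jbelem)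
qed

text \<open>Right translation by \<open>g\<close> changes the central functional by a constant and
  by the correction term of the product, which is a combination of the functionals with index
  \<open>n + j\<close>.\<close>

lemma jcoef_central:
  fixes K :: "'k::field_char_0 itself"
  assumes "0 < n" "g \<in> heis_carrier n" "r \<in> jbasis n"
  shows "jcoef K n g r (jinc (2 * n) jzero) = of_int (of_bool (r = jinc (2 * n) jzero)
    - of_bool (r = jzero) * g (2 * n) - (\<Sum>j<n. g j * of_bool (r = jinc (n + j) jzero)))"
proof -
  have "jcoef K n g r (jinc (2 * n) jzero) =
      pair (\<lambda>v. jdual n (jinc (2 * n) jzero) v - of_int (g (2 * n)) * jdual n jzero v
        - (\<Sum>j<n. of_int (g j) * jdual n (jinc (n + j) jzero) v)) (jbelem n r)"
    using assms by (simp add: jcoef_eq_pair jdual_one heis_mult_def sum_negf algebra_simps)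
  also have "\<dots> = of_bool (r = jinc (2 * n) jzero) - of_int (g (2 * n)) * of_bool (r = jzero)
     - (\<Sum>j<n. of_int (g j) * of_bool (r = jinc (n + j) jzero))"
    using assms(3)
    by (simp only: pair_diff_left pair_scale_left pair_sum_left)
      (simp add: pair_jbelem pair_one_jbelem cong: sum.cong_simp)
  finally show ?thesis by (simp add: mult.commute)
qed

text \<open>Translation by a central element moves only the last coordinate. Among the functionals
  of weight at most 2 only the central one sees it, and it changes by the constant
  \<open>- m\<close>.\<close>

lemma jcoef_center:
  fixes K :: "'k::field_char_0 itself" and m :: int
  assumes "0 < n" "r \<in> jbasis n" "t \<in> jbasis n"
  shows "jcoef K n (heis_one(2 * n := m)) r t =
    of_int (of_bool (r = t) - of_bool (r = jzero \<and> t = jinc (2 * n) jzero) * m)"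
proof -
  let ?g = "heis_one(2 * n := m)"
  have g: "?g \<in> heis_carrier n" by (simp add: heis_carrier_mem heis_one_def)
  have "(\<Sum>j<n. v (n + j) * ?g j) = 0" for v
    by (rule sum.neutral) (auto simp: heis_one_def)
  then have mult: "heis_mult n v ?g i = (if i < 2 * n then v i else if i = 2 * n then v i + m else 0)" for v i
    by (auto simp: heis_mult_def heis_one_def)
  have "jdual n t (heis_mult n v ?g) =
      (jdual n t v - of_bool (t = jinc (2 * n) jzero) * of_int m * jdual n jzero v :: 'k)"
    for v :: "nat \<Rightarrow> int"
    using assms(3)
  proof (cases rule: jbasis_cases)
    case (3 i j)
    moreover have "jinc i (jinc j jzero) \<noteq> jinc (2 * n) jzero"
      using 3 by (auto simp: jinc_def fun_eq_iff)
    ultimately show ?thesis by (simp add: jdual_two mult)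
  qed (auto simp: jdual_one mult)
  then have "jcoef K n ?g r t = pair (\<lambda>v. jdual n t v - of_bool (t = jinc (2 * n) jzero) * of_int m * jdual n jzero v) (jbelem n r)"
    using assms(1-3) g by (simp only: jcoef_eq_pair)
  also have "\<dots> = of_bool (r = t) - of_bool (t = jinc (2 * n) jzero) * of_int m * of_bool (r = jzero)"
    using assms by (simp only: pair_diff_left pair_scale_left) (simp add: pair_jbelem pair_one_jbelem)
  finally show ?thesis by (simp add: of_bool_def)
qed

section \<open>The image of the Jennings representation\<close>

locale jennings_ordering =
  fixes K :: "'k::field_char_0 itself" and n :: nat and \<sigma> :: "(nat \<Rightarrow> nat) \<Rightarrow> nat"
  assumes n_ge_2: "n \<ge> 2"
    and bij: "bij_betw \<sigma> (jbasis n) {..<card (jbasis n)}"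
    and unitriangular: "\<forall>g \<in> heis_carrier n. jmat K n \<sigma> g \<in> carrier (UT (card (jbasis n)))"
begin

abbreviation "d \<equiv> card (jbasis n)"
abbreviation "J \<equiv> jmat K n \<sigma>"
abbreviation "H \<equiv> J ` heis_carrier n"

lemma n_pos: "0 < n"
  using n_ge_2 by simp

lemma sigma_less: "r \<in> jbasis n \<Longrightarrow> \<sigma> r < d"
  using bij_betwE[OF bij] by blast

lemma sigma_inject: "r \<in> jbasis n \<Longrightarrow> t \<in> jbasis n \<Longrightarrow> \<sigma> r = \<sigma> t \<longleftrightarrow> r = t"
  using bij by (auto simp: bij_betw_def inj_on_def)

lemma H_subset: "H \<subseteq> carrier (UT d)"
  using unitriangular by blast

lemma jmat_entry:
  assumes "r \<in> jbasis n" "t \<in> jbasis n" "jcoef K n g r t = of_int z"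
  shows "J g (\<sigma> r) (\<sigma> t) = z"
proof -
  have "inj_on \<sigma> (jbasis n)" using bij by (simp add: bij_betw_def)
  then show ?thesis using assms sigma_less by (simp add: jmat_def inv_into_f_f)
qed

lemma jmat_linear:
  assumes "g \<in> heis_carrier n" "r \<in> jbasis n" "i < 2 * n"
  shows "J g (\<sigma> r) (\<sigma> (jinc i jzero)) = of_bool (r = jinc i jzero) - of_bool (r = jzero) * g i"
  using assms by (intro jmat_entry jcoef_linear n_pos) auto

lemma jmat_central:
  assumes "g \<in> heis_carrier n" "r \<in> jbasis n"
  shows "J g (\<sigma> r) (\<sigma> (jinc (2 * n) jzero)) = of_bool (r = jinc (2 * n) jzero)
    - of_bool (r = jzero) * g (2 * n) - (\<Sum>j<n. g j * of_bool (r = jinc (n + j) jzero))"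
  using assms by (intro jmat_entry jcoef_central n_pos) auto

lemma jmat_diagonal:
  assumes "g \<in> heis_carrier n" "r \<in> jbasis n"
  shows "J g (\<sigma> r) (\<sigma> r) = 1"
  using assms unitriangular sigma_less unfolding UT_carrier by blast

lemma mult_entry:
  assumes "r \<in> jbasis n" "t \<in> jbasis n"
  shows "(A \<otimes>\<^bsub>UT d\<^esub> B) (\<sigma> r) (\<sigma> t) = (\<Sum>s\<in>jbasis n. A (\<sigma> r) (\<sigma> s) * B (\<sigma> s) (\<sigma> t))"
  using assms sigma_less sum.reindex_bij_betw[OF bij, of "\<lambda>k. A (\<sigma> r) k * B k (\<sigma> t)"]
  by (simp add: UT_mult)

lemma jmat_center: "J (heis_one(2 * n := m)) = elem_mat d (\<sigma> jzero) (\<sigma> (jinc (2 * n) jzero)) (- m)"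
proof (intro ext)
  fix p q
  show "J (heis_one(2 * n := m)) p q = elem_mat d (\<sigma> jzero) (\<sigma> (jinc (2 * n) jzero)) (- m) p q"
  proof (cases "p < d \<and> q < d")
    case True
    then obtain r t where rt: "r \<in> jbasis n" "t \<in> jbasis n" "p = \<sigma> r" "q = \<sigma> t"
      using bij unfolding bij_betw_def by (metis imageE lessThan_iff)
    have "J (heis_one(2 * n := m)) p q = of_bool (r = t) - of_bool (r = jzero \<and> t = jinc (2 * n) jzero) * m"
      unfolding rt(3,4) by (rule jmat_entry[OF rt(1,2) jcoef_center[OF n_pos rt(1,2)]])
    then show ?thesis using rt True by (auto simp: elem_mat_def sigma_inject)
  next
    case False
    then show ?thesis by (auto simp: jmat_def elem_mat_def)
  qed
qed

section \<open>Recovering group elements from their matrices\<close>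

lemma jmat_one: "J heis_one = \<one>\<^bsub>UT d\<^esub>"
proof -
  have "heis_one(2 * n := 0) = heis_one" by (auto simp: heis_one_def)
  then have "J heis_one = elem_mat d (\<sigma> jzero) (\<sigma> (jinc (2 * n) jzero)) 0"
    using jmat_center[of 0] by simp
  then show ?thesis by (auto simp: elem_mat_def UT_one fun_eq_iff)
qed

text \<open>The row of the basis element 1 carries the negated Mal'cev coordinates, so it determines
  \<open>k\<close>. Where \<open>H\<close> is known to be closed under products, this makes
  \<open>J\<close> multiplicative.\<close>

lemma jmat_mult_eq:
  assumes "g \<in> heis_carrier n" "h \<in> heis_carrier n" "k \<in> heis_carrier n"
    and "J g \<otimes>\<^bsub>UT d\<^esub> J h = J k"
  shows "k = heis_mult n g h"
proof
  fix i
  have row: "J k (\<sigma> jzero) (\<sigma> t) = (\<Sum>s\<in>jbasis n. J g (\<sigma> jzero) (\<sigma> s) * J h (\<sigma> s) (\<sigma> t))"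
    if "t \<in> jbasis n" for t
    using mult_entry[of jzero t "J g" "J h"] that assms(4) by simp
  have pick: "(\<Sum>s\<in>jbasis n. c s * of_bool (s = t)) = (c t :: int)" if "t \<in> jbasis n" for c t
  proof -
    have "(\<Sum>s\<in>jbasis n. c s * of_bool (s = t)) = (\<Sum>s\<in>jbasis n. if s = t then c s else 0)"
      by (rule sum.cong) auto
    then show ?thesis using that finite_jbasis[of n] by simp
  qed
  have lin: "J g (\<sigma> jzero) (\<sigma> (jinc i jzero)) = - g i" if "g \<in> heis_carrier n" "i < 2 * n" for g i
    using jmat_linear[OF that(1) jzero_in_jbasis that(2)] by simp
  have cen: "J g (\<sigma> jzero) (\<sigma> (jinc (2 * n) jzero)) = - g (2 * n)" if "g \<in> heis_carrier n" for g
    using jmat_central[OF that jzero_in_jbasis] by simp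
  consider "i < 2 * n" | "i = 2 * n" | "i > 2 * n" by linarith
  then show "k i = heis_mult n g h i"
  proof cases
    case 1
    then have i: "jinc i jzero \<in> jbasis n" by simp
    \<comment> \<open>The column of \<open>J h\<close> at a noncentral u_i is nonzero only in the
      rows of u_i and 1.\<close>
    have "- k i = (\<Sum>s\<in>jbasis n. J g (\<sigma> jzero) (\<sigma> s) * of_bool (s = jinc i jzero)
        - h i * (J g (\<sigma> jzero) (\<sigma> s) * of_bool (s = jzero)))"
      using row[OF i] lin[OF assms(3) 1] assms(2) 1
      by (simp add: jmat_linear algebra_simps cong: sum.cong_simp)
    also have "\<dots> = J g (\<sigma> jzero) (\<sigma> (jinc i jzero)) - h i * J g (\<sigma> jzero) (\<sigma> jzero)"
      by (simp only: sum_subtractf sum_distrib_left[symmetric] pick[OF i] pick[OF jzero_in_jbasis])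
    also have "\<dots> = - g i - h i"
      using lin[OF assms(1) 1] jmat_diagonal[OF assms(1) jzero_in_jbasis] by simp
    finally show ?thesis using 1 by (simp add: heis_mult_def)
  next
    case 2
    have w: "jinc (2 * n) jzero \<in> jbasis n" by simp
    let ?a = "\<lambda>s. J g (\<sigma> jzero) (\<sigma> s)"
    have "- k (2 * n) = (\<Sum>s\<in>jbasis n. ?a s * J h (\<sigma> s) (\<sigma> (jinc (2 * n) jzero)))"
      using row[OF w] cen[OF assms(3)] by simp
    \<comment> \<open>The central column also has entries \<open>- h j\<close> in the rows with
      index \<open>n + j\<close>; these produce the correction term of
      \<open>heis_mult\<close>.\<close>
    also have "\<dots> = (\<Sum>s\<in>jbasis n. ?a s * of_bool (s = jinc (2 * n) jzero)
        - h (2 * n) * (?a s * of_bool (s = jzero))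
        - (\<Sum>j<n. h j * (?a s * of_bool (s = jinc (n + j) jzero))))"
      using jmat_central[OF assms(2)]
      by (intro sum.cong refl) (simp only: right_diff_distrib sum_distrib_left mult_ac)
    also have "\<dots> = ?a (jinc (2 * n) jzero) - h (2 * n) * ?a jzero
        - (\<Sum>j<n. h j * (\<Sum>s\<in>jbasis n. ?a s * of_bool (s = jinc (n + j) jzero)))"
      by (simp only: sum_subtractf sum_distrib_left[symmetric] pick[OF w] pick[OF jzero_in_jbasis]
          sum.swap[of _ "{..<n}" "jbasis n"])
    also have "(\<Sum>j<n. h j * (\<Sum>s\<in>jbasis n. ?a s * of_bool (s = jinc (n + j) jzero)))
        = (\<Sum>j<n. - (g (n + j) * h j))"
    proof (intro sum.cong refl)
      fix j assume "j \<in> {..<n}"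
      then have "n + j < 2 * n" "jinc (n + j) jzero \<in> jbasis n" by auto
      then show "h j * (\<Sum>s\<in>jbasis n. ?a s * of_bool (s = jinc (n + j) jzero)) = - (g (n + j) * h j)"
        unfolding pick[OF \<open>jinc (n + j) jzero \<in> jbasis n\<close>] using lin[OF assms(1)] by simp
    qed
    finally show ?thesis
      using 2 cen[OF assms(1)] jmat_diagonal[OF assms(1) jzero_in_jbasis]
      by (simp add: heis_mult_def sum_negf)
  next
    case 3
    then show ?thesis using assms(3) by (auto simp: heis_mult_def heis_carrier_mem)
  qed
qed

text \<open>The case \<open>h = heis_one\<close> of the previous result.\<close>

lemma jmat_inject:
  assumes "g \<in> heis_carrier n" "k \<in> heis_carrier n" "J g = J k"
  shows "g = k"
proof -
  have "J g \<otimes>\<^bsub>UT d\<^esub> J heis_one = J k"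
    using assms unitriangular by (simp add: jmat_one monoid.r_one[OF monoid_UT])
  from jmat_mult_eq[OF assms(1) heis_one_closed assms(2) this] show ?thesis using assms(1) by simp
qed

text \<open>A nonzero off-diagonal entry forces its row to precede its column. The generator with
  index \<open>n + j\<close> has entry -1 in the first position needed, the one with index
  \<open>j\<close> in the second.\<close>

lemma sigma_order:
  assumes "j < n"
  shows "\<sigma> jzero < \<sigma> (jinc (n + j) jzero)" "\<sigma> (jinc (n + j) jzero) < \<sigma> (jinc (2 * n) jzero)"
proof -
  have less: "\<sigma> r < \<sigma> t"
    if "g \<in> heis_carrier n" "r \<in> jbasis n" "t \<in> jbasis n" "J g (\<sigma> r) (\<sigma> t) \<noteq> 0" "r \<noteq> t" for g r t
  proof -
    have "\<not> \<sigma> t < \<sigma> r"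
      using unitriangular that(1,4) sigma_less[OF that(2)] sigma_less[OF that(3)]
      unfolding UT_carrier by blast
    moreover have "\<sigma> r \<noteq> \<sigma> t" using that by (simp add: sigma_inject)
    ultimately show ?thesis by simp
  qed
  show "\<sigma> jzero < \<sigma> (jinc (n + j) jzero)"
    using assms by (intro less[of "heis_gen (n + j)"]) (auto simp: jmat_linear, simp add: heis_gen_def)
  have "(\<Sum>i<n. heis_gen j i * of_bool (jinc (n + j) jzero = jinc (n + i) jzero))
      = (\<Sum>i<n. if i = j then 1 else (0::int))"
    by (rule sum.cong) (auto simp: heis_gen_def)
  then have "(\<Sum>i<n. heis_gen j i * of_bool (jinc (n + j) jzero = jinc (n + i) jzero)) = 1"
    using assms by simp
  then show "\<sigma> (jinc (n + j) jzero) < \<sigma> (jinc (2 * n) jzero)"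
    using assms by (intro less[of "heis_gen j"]) (simp_all add: jmat_central)
qed

section \<open>Lengths of central elements in the two groups\<close>

lemma center_word_len_UT:
  assumes "generate (UT d) T = carrier (UT d)"
  shows "\<exists>C. \<forall>m. word_len (UT d) T (J (heis_one(2 * n := int m ^ 3))) \<le> C * m"
proof -
  \<comment> \<open>Since \<open>n\<close> is at least 2 there are two intermediate positions. Their
    mutual order depends on \<open>\<sigma>\<close>, so the cubic bound is used in both
    orders.\<close>
  let ?k = "\<sigma> (jinc (n + 0) jzero)" and ?l = "\<sigma> (jinc (n + 1) jzero)"
  have "?k \<noteq> ?l" using n_ge_2 by (subst sigma_inject) auto
  moreover have k: "\<sigma> jzero < ?k" "?k < \<sigma> (jinc (2 * n) jzero)"
    and l: "\<sigma> jzero < ?l" "?l < \<sigma> (jinc (2 * n) jzero)"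
    using sigma_order[of 0] sigma_order[of 1] n_ge_2 by auto
  moreover have "\<sigma> (jinc (2 * n) jzero) < d" by (rule sigma_less) simp
  ultimately show ?thesis unfolding jmat_center
    using word_len_elem_mat_cube[OF assms, of "\<sigma> jzero" ?k ?l "\<sigma> (jinc (2 * n) jzero)"]
      word_len_elem_mat_cube[OF assms, of "\<sigma> jzero" ?l ?k "\<sigma> (jinc (2 * n) jzero)"]
    by (meson nat_neq_iff)
qed

text \<open>Along a word the noncentral coordinates grow linearly. Each letter changes the central
  one by a bounded amount plus a term linear in the current length, which sums to a quadratic
  bound.\<close>

lemma center_quadratic_bound:
  assumes "finite S" "S \<subseteq> H" and gen: "generate (UT d\<lparr>carrier := H\<rparr>) S = H"
  shows "\<exists>M::int. \<forall>g\<in>heis_carrier n. \<bar>g (2 * n)\<bar> \<le> M * int (word_len (UT d\<lparr>carrier := H\<rparr>) S (J g)) ^ 2"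
proof -
  let ?G = "UT d\<lparr>carrier := H\<rparr>"
  let ?F = "S \<union> m_inv ?G ` S"
  \<comment> \<open>\<open>H\<close> equals a generated set, and generated sets are closed under
    products.\<close>
  have closed: "A \<otimes>\<^bsub>UT d\<^esub> B \<in> H" if "A \<in> H" "B \<in> H" for A B
    using generate.eng[of A ?G S B] that gen by simp
  have mon: "monoid ?G"
  proof (rule monoidI)
    show "\<one>\<^bsub>?G\<^esub> \<in> carrier ?G" using generate.one[of ?G S] gen by simp
  next
    fix A B C assume "A \<in> carrier ?G" "B \<in> carrier ?G" "C \<in> carrier ?G"
    then have "A \<in> H" "B \<in> H" "C \<in> H" by simp_all
    then show "A \<otimes>\<^bsub>?G\<^esub> B \<in> carrier ?G" "\<one>\<^bsub>?G\<^esub> \<otimes>\<^bsub>?G\<^esub> A = A" "A \<otimes>\<^bsub>?G\<^esub> \<one>\<^bsub>?G\<^esub> = A"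
      "A \<otimes>\<^bsub>?G\<^esub> B \<otimes>\<^bsub>?G\<^esub> C = A \<otimes>\<^bsub>?G\<^esub> (B \<otimes>\<^bsub>?G\<^esub> C)"
      using closed subsetD[OF H_subset]
      by (simp_all add: monoid.m_assoc[OF monoid_UT] monoid.l_one[OF monoid_UT] monoid.r_one[OF monoid_UT])
  qed
  have F: "?F \<subseteq> H" "finite ?F" using inv_image_subset_generate[of S ?G] gen assms(1) by auto
  have "\<exists>c. \<forall>A\<in>?F. c A \<in> heis_carrier n \<and> A = J (c A)" using F(1) by (intro bchoice) blast
  then obtain c where c: "\<And>A. A \<in> ?F \<Longrightarrow> c A \<in> heis_carrier n" "\<And>A. A \<in> ?F \<Longrightarrow> A = J (c A)" by blast
  \<comment> \<open>A crude common bound for all coordinates of the chosen preimages of the finitely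
    many letters.\<close>
  define M where "M = (\<Sum>A\<in>?F. \<Sum>i\<le>2*n. \<bar>c A i\<bar>)"
  have M: "\<bar>c A i\<bar> \<le> M" if "A \<in> ?F" "i \<le> 2 * n" for A i
  proof -
    have "\<bar>c A i\<bar> \<le> (\<Sum>i\<le>2*n. \<bar>c A i\<bar>)"
      using that(2) by (intro member_le_sum) auto
    also have "\<dots> \<le> M" unfolding M_def
      using that(1) F(2) by (intro member_le_sum[of A ?F "\<lambda>A. \<Sum>i\<le>2*n. \<bar>c A i\<bar>"]) (auto intro: sum_nonneg)
    finally show ?thesis .
  qed
  have M0: "0 \<le> M" unfolding M_def by (intro sum_nonneg) auto
  \<comment> \<open>The linear bound on noncentral coordinates is carried along because it controls
    the correction term when the next letter is multiplied on the left.\<close>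
  have word: "\<exists>v\<in>heis_carrier n. foldr (mult (UT d)) ws \<one>\<^bsub>UT d\<^esub> = J v \<and>
      (\<forall>i<2*n. \<bar>v i\<bar> \<le> M * int (length ws)) \<and>
      \<bar>v (2*n)\<bar> \<le> M * int (length ws) + int n * M\<^sup>2 * (int (length ws))\<^sup>2" if "set ws \<subseteq> ?F" for ws
    using that
  proof (induction ws)
    case Nil
    show ?case by (rule bexI[of _ heis_one]) (auto simp: jmat_one, auto simp: heis_one_def)
  next
    case (Cons A ws)
    let ?L = "int (length ws)"
    obtain v where v: "v \<in> heis_carrier n" "foldr (mult (UT d)) ws \<one>\<^bsub>UT d\<^esub> = J v"
      "\<And>i. i < 2*n \<Longrightarrow> \<bar>v i\<bar> \<le> M * ?L" "\<bar>v (2*n)\<bar> \<le> M * ?L + int n * M\<^sup>2 * ?L\<^sup>2"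
      using Cons by auto
    have A: "A \<in> ?F" using Cons.prems by simp
    let ?g = "c A"
    have "J ?g \<otimes>\<^bsub>UT d\<^esub> J v \<in> H" using closed c(1)[OF A] v(1) by blast
    then obtain k where k: "k \<in> heis_carrier n" "J ?g \<otimes>\<^bsub>UT d\<^esub> J v = J k" by blast
    have keq: "k = heis_mult n ?g v" by (rule jmat_mult_eq[OF c(1)[OF A] v(1) k])
    have small: "\<bar>k i\<bar> \<le> M * (?L + 1)" if "i < 2 * n" for i
      using M[OF A, of i] v(3)[OF that] that unfolding keq by (simp add: heis_mult_def algebra_simps)
    have "\<bar>\<Sum>j<n. ?g (n + j) * v j\<bar> \<le> (\<Sum>j<n. \<bar>?g (n + j) * v j\<bar>)" by (rule sum_abs)
    also have "\<dots> \<le> (\<Sum>j<n. M * (M * ?L))"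
      unfolding abs_mult using M[OF A] v(3) M0 by (intro sum_mono mult_mono) auto
    finally have "\<bar>\<Sum>j<n. ?g (n + j) * v j\<bar> \<le> int n * M\<^sup>2 * ?L" by (simp add: power2_eq_square)
    then have "\<bar>k (2*n)\<bar> \<le> M + (M * ?L + int n * M\<^sup>2 * ?L\<^sup>2) + int n * M\<^sup>2 * ?L"
      using M[OF A, of "2*n"] v(4) unfolding keq by (simp add: heis_mult_def)
    also have "\<dots> \<le> M * (?L + 1) + int n * M\<^sup>2 * (?L + 1)\<^sup>2"
    proof -
      have "0 \<le> int n * M\<^sup>2 * (?L + 1)" by simp
      then show ?thesis by (simp add: power2_eq_square algebra_simps)
    qed
    finally have "\<bar>k (2*n)\<bar> \<le> M * (?L + 1) + int n * M\<^sup>2 * (?L + 1)\<^sup>2" .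
    moreover have "foldr (mult (UT d)) (A # ws) \<one>\<^bsub>UT d\<^esub> = J k" using v(2) k(2) c(2)[OF A] by simp
    ultimately show ?case using small k(1) by (intro bexI[of _ k]) (auto simp: add.commute)
  qed
  have "\<bar>g (2 * n)\<bar> \<le> (M + int n * M\<^sup>2) * int (word_len ?G S (J g)) ^ 2" if g: "g \<in> heis_carrier n" for g
  proof -
    have gG: "generate ?G S = carrier ?G" "J g \<in> carrier ?G" using gen g by auto
    obtain ws where ws: "length ws = word_len ?G S (J g)" "set ws \<subseteq> ?F"
      "foldr (mult ?G) ws \<one>\<^bsub>?G\<^esub> = J g" using word_len_attained[OF mon gG] by blast
    let ?L = "int (length ws)"
    obtain v where v: "v \<in> heis_carrier n" "J g = J v"
      "\<bar>v (2*n)\<bar> \<le> M * ?L + int n * M\<^sup>2 * ?L\<^sup>2" using word[OF ws(2)] ws(3) by auto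
    \<comment> \<open>A natural number is at most its square, so the linear term merges into the
      quadratic one.\<close>
    have "?L \<le> ?L\<^sup>2" by (cases "length ws") (simp_all add: power2_eq_square algebra_simps)
    then have "M * ?L \<le> M * ?L\<^sup>2" using M0 by (rule mult_left_mono)
    then show ?thesis using v jmat_inject[OF g v(1,2)] ws(1) by (simp add: algebra_simps)
  qed
  then show ?thesis by blast
qed

text \<open>The central element with coordinate m^3 has length at most \<open>C1 * m\<close> in the
  unitriangular group, while its length L in the image satisfies m^3 \<le> M L^2. Under linear
  distortion L is O(m), which would bound m.\<close>

lemma distorted_image: "distorted (UT d) H"
  unfolding distorted_def
proof (intro allI impI notI)
  fix S T
  assume "finite S \<and> S \<subseteq> H \<and> generate (UT d\<lparr>carrier := H\<rparr>) S = H \<and>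
      finite T \<and> T \<subseteq> carrier (UT d) \<and> generate (UT d) T = carrier (UT d)"
  then have S: "finite S" "S \<subseteq> H" "generate (UT d\<lparr>carrier := H\<rparr>) S = H"
    and T: "finite T" "generate (UT d) T = carrier (UT d)" by auto
  assume "\<exists>C::real. \<forall>m. real (distortion (UT d) H S T m) \<le> C * real m"
  then obtain C :: real where C: "\<And>m. real (distortion (UT d) H S T m) \<le> C * real m" by blast
  obtain C1 where C1: "\<And>m. word_len (UT d) T (J (heis_one(2 * n := int m ^ 3))) \<le> C1 * m"
    using center_word_len_UT[OF T(2)] by blast
  obtain M :: int where M: "\<And>g. g \<in> heis_carrier n \<Longrightarrow>
      \<bar>g (2 * n)\<bar> \<le> M * int (word_len (UT d\<lparr>carrier := H\<rparr>) S (J g)) ^ 2"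
    using center_quadratic_bound[OF S] by blast
  have bound: "real m \<le> \<bar>real_of_int M\<bar> * (C * real C1)\<^sup>2" if "m > 0" for m
  proof -
    let ?g = "heis_one(2 * n := int m ^ 3)"
    let ?L = "word_len (UT d\<lparr>carrier := H\<rparr>) S (J ?g)"
    have g: "?g \<in> heis_carrier n" by (simp add: heis_carrier_mem heis_one_def)
    have "?L \<le> distortion (UT d) H S T (C1 * m)"
      by (rule word_len_le_distortion[OF monoid_UT T(2,1) H_subset _ C1]) (use g in blast)
    then have L: "real ?L \<le> C * real C1 * real m" using C[of "C1 * m"] by (simp add: mult.assoc)
    have "int m ^ 3 \<le> M * int ?L ^ 2" using M[OF g] by simp
    then have "real_of_int (int m ^ 3) \<le> real_of_int (M * int ?L ^ 2)" by (simp only: of_int_le_iff)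
    then have "real m ^ 3 \<le> real_of_int M * real ?L ^ 2" by simp
    \<comment> \<open>The absolute value is taken because the sign of \<open>M\<close> is not
      recorded.\<close>
    also have "\<dots> \<le> \<bar>real_of_int M\<bar> * (C * real C1 * real m) ^ 2"
      using L by (intro mult_mono power_mono) auto
    finally have "real m * real m ^ 2 \<le> \<bar>real_of_int M\<bar> * (C * real C1)\<^sup>2 * real m ^ 2"
      by (simp add: power3_eq_cube power2_eq_square mult_ac)
    then show ?thesis using that by (simp only: mult_le_cancel_right) simp
  qed
  obtain m where "real m > \<bar>real_of_int M\<bar> * (C * real C1)\<^sup>2" using reals_Archimedean2 by blast
  moreover from this have "m > 0"
    by (metis abs_ge_zero gr0I mult_nonneg_nonneg not_less of_nat_0 zero_le_power2)
  ultimately show False using bound[of m] by simp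
qed

end

theorem theorem4p2:
  fixes K :: "'k::field_char_0 itself" and n :: nat and \<sigma> :: "(nat \<Rightarrow> nat) \<Rightarrow> nat"
  assumes "n \<ge> 2"
    and "bij_betw \<sigma> (jbasis n) {..<card (jbasis n)}"
    and "\<forall>g \<in> heis_carrier n. jmat K n \<sigma> g \<in> carrier (UT (card (jbasis n)))"
  shows "distorted (UT (card (jbasis n))) (jmat K n \<sigma> ` heis_carrier n)"
proof -
  interpret jennings_ordering K n \<sigma> by unfold_locales (use assms in auto)
  show ?thesis by (rule distorted_image)
qed

end
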